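(* Let $k$ be a field of characteristic $0$ and let $\operatorname{Spec}(A_n)$ be an affine toric Gorenstein surface, $A_n=k[x,y,z]/(xy-z^{n+1})$. Then the Gerstenhaber product $\operatorname{HH}^2(A_n)\times\operatorname{HH}^2(A_n)\to\operatorname{HH}^3(A_n)$ is the zero map.
   Context: $n\ge 1$ is an integer. $A_n=k[\Lambda_n]$, where $\Lambda_n\subset\mathbb Z^2$ is the semigroup generated by $S_1=(0,1)$, $S_2=(1,1)$, $S_3=(n+1,n)$, with relation $S_1+S_3=(n+1)S_2$. For a $k$-algebra $A$, $\operatorname{HH}^m(A)$ is the $m$-th Hochschild cohomology group of $A$ (over $k$, with coefficients in $A$), computed by the Hochschild cochain complex $C^m(A)=\operatorname{Hom}_k(A^{\otimes m},A)$. The Gerstenhaber bracket $[\cdot,\cdot]:C^p(A)\times C^q(A)\to C^{p+q-1}(A)$ is $[f,g]=f\circ g-(-1)^{(p-1)(q-1)}g\circ f$ with $$(f\circ g)(x_1,\dots,x_{p+q-1})=\sum_{i=1}^{p}(-1)^{(i-1)(q-1)}f(x_1,\dots,x_{i-1},g(x_i,\dots,x_{i+q-1}),x_{i+q},\dots,x_{p+q-1}).$$ The Gerstenhaber product is the induced map $[\cdot,\cdot]:\operatorname{HH}^2(A)\times\operatorname{HH}^2(A)\to\operatorname{HH}^3(A)$. *)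

theory Defs
  imports
    Complex_Main
    "HOL-Algebra.Coset"
    "HOL-Library.Poly_Mapping"
    "HOL-Library.Product_Plus"
begin

section \<open>Hochschild cohomology and the Gerstenhaber bracket\<close>

text \<open>
  A \<open>k\<close>-algebra is a carrier set \<open>A\<close> inside an ambient ring with scalar action \<open>scale\<close>, so that
  families of algebras may depend on numeric parameters. The ambient one is required to be
  unital, and \<open>A\<close> shares its unit.
\<close>

locale k_algebra = vector_space scale
  for scale :: "'k::field \<Rightarrow> 'a::ring_1 \<Rightarrow> 'a" (infixr \<open>*s\<close> 75) +
  fixes A :: "'a set"
  assumes subspace_A: "subspace A"
    and one_A: "1 \<in> A"
    and mult_A: "a \<in> A \<Longrightarrow> b \<in> A \<Longrightarrow> a * b \<in> A"
    and scale_mult_left: "a \<in> A \<Longrightarrow> b \<in> A \<Longrightarrow> (c *s a) * b = c *s (a * b)"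
    and scale_mult_right: "a \<in> A \<Longrightarrow> b \<in> A \<Longrightarrow> a * (c *s b) = c *s (a * b)"
begin

definition tuples :: "nat \<Rightarrow> 'a list set" where
  "tuples m = {xs \<in> lists A. length xs = m}"

text \<open>
  A linear map \<open>A\<^sup>\<otimes>\<^sup>m \<rightarrow> A\<close> is represented by the corresponding \<open>m\<close>-multilinear map. It takes the
  value \<open>0\<close> outside \<open>A\<^sup>m\<close>, which makes the representing function unique.
\<close>

definition cochains :: "nat \<Rightarrow> ('a list \<Rightarrow> 'a) set" where
  "cochains m = {f.
     (\<forall>xs \<in> tuples m. f xs \<in> A) \<and>
     (\<forall>xs. xs \<notin> tuples m \<longrightarrow> f xs = 0) \<and>
     (\<forall>xs ys a b c. xs @ a # ys \<in> tuples m \<longrightarrow> b \<in> A \<longrightarrow>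
        f (xs @ (c *s a + b) # ys) = c *s f (xs @ a # ys) + f (xs @ b # ys))}"

text \<open>The additive group \<open>C\<^sup>m(A)\<close>, written multiplicatively as \<open>HOL-Algebra\<close> quotient groups are.\<close>

definition cochain_group :: "nat \<Rightarrow> ('a list \<Rightarrow> 'a) monoid" where
  "cochain_group m =
     \<lparr>carrier = cochains m, monoid.mult = (\<lambda>f g xs. f xs + g xs), one = (\<lambda>xs. 0)\<rparr>"

definition coboundary :: "nat \<Rightarrow> ('a list \<Rightarrow> 'a) \<Rightarrow> 'a list \<Rightarrow> 'a" where
  "coboundary m f = (\<lambda>xs. if xs \<in> tuples (Suc m) then
       xs ! 0 * f (drop 1 xs)
       + (\<Sum>i<m. (-1) ^ (i + 1) * f (take i xs @ (xs ! i * xs ! (i + 1)) # drop (i + 2) xs))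
       + (-1) ^ (m + 1) * (f (take m xs) * xs ! m)
     else 0)"

definition cocycle_group :: "nat \<Rightarrow> ('a list \<Rightarrow> 'a) monoid" where
  "cocycle_group m = (cochain_group m)
     \<lparr>carrier := kernel (cochain_group m) (cochain_group (Suc m)) (coboundary m)\<rparr>"

definition coboundaries :: "nat \<Rightarrow> ('a list \<Rightarrow> 'a) set" where
  "coboundaries m =
     (case m of 0 \<Rightarrow> {\<one>\<^bsub>cochain_group 0\<^esub>} | Suc l \<Rightarrow> coboundary l ` cochains l)"

definition HH :: "nat \<Rightarrow> ('a list \<Rightarrow> 'a) set monoid" where
  "HH m = cocycle_group m Mod coboundaries m"

text \<open>
  Below, the summation index is shifted to start at \<open>0\<close>, and the exponents \<open>p - 1\<close>, \<open>q - 1\<close> of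
  \<open>-1\<close> are replaced by \<open>p + 1\<close>, \<open>q + 1\<close>, which have the same parity and avoid truncated
  subtraction at \<open>0\<close>.
\<close>

definition circ :: "nat \<Rightarrow> nat \<Rightarrow> ('a list \<Rightarrow> 'a) \<Rightarrow> ('a list \<Rightarrow> 'a) \<Rightarrow> 'a list \<Rightarrow> 'a" where
  "circ p q f g = (\<lambda>xs. if xs \<in> tuples (p + q - 1) then
       (\<Sum>i<p. (-1) ^ (i * (q + 1)) * f (take i xs @ g (take q (drop i xs)) # drop (i + q) xs))
     else 0)"

definition gerstenhaber_bracket ::
    "nat \<Rightarrow> nat \<Rightarrow> ('a list \<Rightarrow> 'a) \<Rightarrow> ('a list \<Rightarrow> 'a) \<Rightarrow> 'a list \<Rightarrow> 'a" where
  "gerstenhaber_bracket p q f g =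
     (\<lambda>xs. circ p q f g xs - (-1) ^ ((p + 1) * (q + 1)) * circ q p g f xs)"

text \<open>
  The map induced on classes: the union of the classes of \<open>[f, g]\<close> over all representatives. It is
  a single class precisely when that class is independent of the representatives.
\<close>

definition gerstenhaber_product ::
    "nat \<Rightarrow> nat \<Rightarrow> ('a list \<Rightarrow> 'a) set \<Rightarrow> ('a list \<Rightarrow> 'a) set \<Rightarrow> ('a list \<Rightarrow> 'a) set" where
  "gerstenhaber_product p q X Y =
     (\<Union>f\<in>X. \<Union>g\<in>Y. coboundaries (p + q - 1) #>\<^bsub>cocycle_group (p + q - 1)\<^esub>
        gerstenhaber_bracket p q f g)"

end


section \<open>The semigroup algebras \<open>A\<^sub>n = k[\<Lambda>\<^sub>n]\<close>\<close>

text \<open>The semigroup contains \<open>0\<close>, so that its algebra is unital.\<close>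

inductive_set Lambda :: "nat \<Rightarrow> (int \<times> int) set" for n :: nat where
  zero: "0 \<in> Lambda n"
| gen: "s \<in> {(0, 1), (1, 1), (int n + 1, int n)} \<Longrightarrow> v \<in> Lambda n \<Longrightarrow> s + v \<in> Lambda n"

definition pm_scale :: "'k::field \<Rightarrow> ('m \<Rightarrow>\<^sub>0 'k) \<Rightarrow> ('m \<Rightarrow>\<^sub>0 'k)" where
  "pm_scale c p = Poly_Mapping.map ((*) c) p"

text \<open>
  \<open>k[\<Lambda>\<^sub>n]\<close> as a subalgebra of the group algebra \<open>k[\<int>\<^sup>2]\<close>: multiplication on
  \<open>int \<times> int \<Rightarrow>\<^sub>0 'k\<close> is the convolution product.
\<close>

definition A_n :: "nat \<Rightarrow> ((int \<times> int) \<Rightarrow>\<^sub>0 'k::field) set" where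
  "A_n n = {p. Poly_Mapping.keys p \<subseteq> Lambda n}"

lemma lookup_pm_scale [simp]: "Poly_Mapping.lookup (pm_scale c p) m = c * Poly_Mapping.lookup p m"
  by (simp add: pm_scale_def Poly_Mapping.map.rep_eq Poly_Mapping.when_def)

lemma pm_scale_conv_mult:
  "pm_scale c p = Poly_Mapping.single (0::'m::monoid_add) c * p"
  unfolding pm_scale_def by (rule mult_map_scale_conv_mult)

lemma pm_scale_mult_right:
  fixes a b :: "'m::comm_monoid_add \<Rightarrow>\<^sub>0 'k::field"
  shows "a * pm_scale c b = pm_scale c (a * b)"
  by (simp add: pm_scale_conv_mult mult.left_commute)

lemma vector_space_pm_scale: "vector_space (pm_scale :: 'k::field \<Rightarrow> ('m \<Rightarrow>\<^sub>0 'k) \<Rightarrow> _)"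
  by unfold_locales (auto intro!: poly_mapping_eqI simp: lookup_add algebra_simps)

lemma Lambda_add: "v \<in> Lambda n \<Longrightarrow> w \<in> Lambda n \<Longrightarrow> v + w \<in> Lambda n"
  by (induction rule: Lambda.induct) (auto simp: add.assoc intro: Lambda.gen)

lemma k_algebra_A_n: "k_algebra pm_scale (A_n n :: ((int \<times> int) \<Rightarrow>\<^sub>0 'k::field) set)"
proof -
  interpret vector_space "pm_scale :: 'k \<Rightarrow> ((int \<times> int) \<Rightarrow>\<^sub>0 'k) \<Rightarrow> _"
    by (rule vector_space_pm_scale)
  show ?thesis
  proof
    show "subspace (A_n n :: ((int \<times> int) \<Rightarrow>\<^sub>0 'k) set)"
    proof (rule subspaceI)
      show "x + y \<in> A_n n" if "x \<in> A_n n" "y \<in> A_n n" for x y :: "(int \<times> int) \<Rightarrow>\<^sub>0 'k"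
        using that Poly_Mapping.keys_add[of x y] by (auto simp: A_n_def)
    qed (auto simp: A_n_def in_keys_iff)
    show "1 \<in> A_n n"
      by (simp add: A_n_def Lambda.zero)
    show "a * b \<in> A_n n" if "a \<in> A_n n" "b \<in> A_n n" for a b :: "(int \<times> int) \<Rightarrow>\<^sub>0 'k"
      using that Poly_Mapping.keys_mult[of a b] unfolding A_n_def mem_Collect_eq
      by (smt (verit) Lambda_add mem_Collect_eq subset_iff)
  qed (simp_all add: pm_scale_mult_right pm_scale_conv_mult mult.assoc)
qed

interpretation A_n: k_algebra pm_scale "A_n n :: ((int \<times> int) \<Rightarrow>\<^sub>0 'k::field) set" for n
  by (rule k_algebra_A_n)


subsection \<open>The presentation \<open>A\<^sub>n \<cong> k[x,y,z]/(xy - z\<^sup>n\<^sup>+\<^sup>1)\<close>\<close>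

text \<open>The monomial \<open>x\<^sup>a y\<^sup>b z\<^sup>c\<close> of \<open>k[x,y,z]\<close> is \<open>Poly_Mapping.single (a, b, c) 1\<close>.\<close>

type_synonym 'k poly3 = "(nat \<times> nat \<times> nat) \<Rightarrow>\<^sub>0 'k"

definition var_x :: "'k::field poly3" where "var_x = Poly_Mapping.single (1, 0, 0) 1"
definition var_y :: "'k::field poly3" where "var_y = Poly_Mapping.single (0, 1, 0) 1"
definition var_z :: "'k::field poly3" where "var_z = Poly_Mapping.single (0, 0, 1) 1"

definition push :: "('m \<Rightarrow> 'l) \<Rightarrow> ('m \<Rightarrow>\<^sub>0 'k::field) \<Rightarrow> ('l \<Rightarrow>\<^sub>0 'k)" where
  "push h p =
     (\<Sum>m\<in>Poly_Mapping.keys p. Poly_Mapping.single (h m) (Poly_Mapping.lookup p m))"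

lemma push_single [simp]: "push h (Poly_Mapping.single m u) = Poly_Mapping.single (h m) u"
  by (simp add: push_def)

lemma push_zero [simp]: "push h 0 = 0"
  by (simp add: push_def)

lemma push_add: "push h (p + q) = push h p + push h q"
  unfolding push_def by (rule setsum_keys_plus_distrib) (auto simp: single_add)

lemma push_sum: "push h (sum F I) = (\<Sum>i\<in>I. push h (F i))"
  by (induction I rule: infinite_finite_induct) (auto simp: push_add)

lemma push_id: "push (\<lambda>m. m) p = p"
proof (rule poly_mapping_eqI)
  fix k
  have "Poly_Mapping.lookup (push (\<lambda>m. m) p) k =
      (\<Sum>m\<in>Poly_Mapping.keys p. if m = k then Poly_Mapping.lookup p m else 0)"
    by (simp add: push_def lookup_sum lookup_single when_def)
  also have "\<dots> = Poly_Mapping.lookup p k"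
    by (auto simp: in_keys_iff)
  finally show "Poly_Mapping.lookup (push (\<lambda>m. m) p) k = Poly_Mapping.lookup p k" .
qed

lemma push_push: "push g (push h p) = push (g \<circ> h) p"
proof -
  have "push g (push h p)
      = (\<Sum>m\<in>Poly_Mapping.keys p. push g (Poly_Mapping.single (h m) (Poly_Mapping.lookup p m)))"
    unfolding push_def[of h p] by (rule push_sum)
  then show ?thesis
    by (simp add: push_def[of "g \<circ> h" p])
qed

lemma push_mult:
  assumes "\<And>m m'. h (m + m') = h m + h m'"
  shows "push h (p * q) = push h p * push h q"
proof -
  have "p * q = (\<Sum>m\<in>Poly_Mapping.keys p. Poly_Mapping.single m (Poly_Mapping.lookup p m))
              * (\<Sum>m\<in>Poly_Mapping.keys q. Poly_Mapping.single m (Poly_Mapping.lookup q m))"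
    using push_id[of p] push_id[of q] by (simp add: push_def)
  then have "push h (p * q) = (\<Sum>m\<in>Poly_Mapping.keys p. \<Sum>m'\<in>Poly_Mapping.keys q.
      Poly_Mapping.single (h m + h m') (Poly_Mapping.lookup p m * Poly_Mapping.lookup q m'))"
    by (simp add: sum_product mult_single push_sum assms)
  also have "\<dots> = push h p * push h q"
    by (simp add: push_def sum_product mult_single)
  finally show ?thesis .
qed

text \<open>The exponent of the image of \<open>x\<^sup>a y\<^sup>b z\<^sup>c\<close> under \<open>x \<mapsto> S\<^sub>1\<close>, \<open>y \<mapsto> S\<^sub>3\<close>, \<open>z \<mapsto> S\<^sub>2\<close>.\<close>

definition toric_exp :: "nat \<Rightarrow> nat \<times> nat \<times> nat \<Rightarrow> int \<times> int" where
  "toric_exp n = (\<lambda>(a, b, c). (int b * (int n + 1) + int c, int a + int b * int n + int c))"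

definition toric_section :: "nat \<Rightarrow> int \<times> int \<Rightarrow> nat \<times> nat \<times> nat" where
  "toric_section n = (\<lambda>(p, q). if q \<ge> p then (nat (q - p), 0, nat p)
     else (0, nat (p - q), nat (p - (p - q) * (int n + 1))))"

lemma toric_exp_add: "toric_exp n (m + m') = toric_exp n m + toric_exp n m'"
  by (auto simp: toric_exp_def algebra_simps split: prod.splits)

lemma toric_exp_in_Lambda: "toric_exp n m \<in> Lambda n"
proof -
  have gens: "(0, 1) \<in> Lambda n" "(1, 1) \<in> Lambda n" "(int n + 1, int n) \<in> Lambda n"
    using Lambda.gen[OF _ Lambda.zero, of _ n] by (auto simp del: add_Pair)
  obtain a b c where m: "m = (a, b, c)" by (cases m)
  have "(0, int a) \<in> Lambda n"
    by (induction a) (use Lambda_add[OF gens(1)] Lambda.zero[of n] in \<open>force simp: zero_prod_def\<close>)+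
  moreover have "(int b * (int n + 1), int b * int n) \<in> Lambda n"
    by (induction b) (use Lambda_add[OF gens(3)] Lambda.zero[of n] in
        \<open>force simp: zero_prod_def algebra_simps\<close>)+
  moreover have "(int c, int c) \<in> Lambda n"
    by (induction c) (use Lambda_add[OF gens(2)] Lambda.zero[of n] in \<open>force simp: zero_prod_def\<close>)+
  ultimately have "(0, int a) + (int b * (int n + 1), int b * int n) + (int c, int c) \<in> Lambda n"
    by (intro Lambda_add)
  then show ?thesis by (simp add: m toric_exp_def)
qed

lemma Lambda_eq_range: "Lambda n = range (toric_exp n)"
proof
  show "Lambda n \<subseteq> range (toric_exp n)"
  proof
    fix v assume "v \<in> Lambda n"
    then show "v \<in> range (toric_exp n)"
    proof induction
      case zero
      have "toric_exp n 0 = 0" by (simp add: toric_exp_def zero_prod_def)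
      then show ?case by (metis rangeI)
    next
      case (gen s v)
      have "toric_exp n (1, 0, 0) = (0, 1)" "toric_exp n (0, 0, 1) = (1, 1)"
        "toric_exp n (0, 1, 0) = (int n + 1, int n)"
        by (auto simp: toric_exp_def)
      then obtain t where "s = toric_exp n t" using gen(1) by (metis insertE singletonD)
      moreover obtain m where "v = toric_exp n m" using gen by blast
      ultimately show ?case by (metis toric_exp_add rangeI)
    qed
  qed
qed (auto intro: toric_exp_in_Lambda)

definition rel_poly :: "nat \<Rightarrow> 'k::field poly3" where
  "rel_poly n = var_x * var_y - var_z ^ (n + 1)"

lemma var_z_power: "var_z ^ j = (Poly_Mapping.single (0, 0, j) 1 :: 'k::field poly3)"
proof (induction j)
  case 0
  show ?case by (simp add: zero_prod_def[symmetric])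
next
  case (Suc j)
  then show ?case by (simp add: mult_single var_z_def)
qed

lemma rel_poly_eq:
  "rel_poly n = Poly_Mapping.single (1, 1, 0) 1 - Poly_Mapping.single (0, 0, n + 1) 1"
  unfolding rel_poly_def var_z_power by (simp add: var_x_def var_y_def mult_single)

lemma rel_poly_dvd_monom:
  "(rel_poly n :: 'k::field poly3) dvd
     Poly_Mapping.single (a + j, b + j, c) u - Poly_Mapping.single (a, b, c + j * (n + 1)) u"
proof (induction j arbitrary: c)
  case (Suc j)
  have "Poly_Mapping.single (a + Suc j, b + Suc j, c) u
        - Poly_Mapping.single (a + j, b + j, c + (n + 1)) u
      = rel_poly n * Poly_Mapping.single (a + j, b + j, c) u"
    by (simp add: rel_poly_eq left_diff_distrib mult_single add.commute)
  then have "(rel_poly n :: 'k poly3) dvd Poly_Mapping.single (a + Suc j, b + Suc j, c) u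
        - Poly_Mapping.single (a + j, b + j, c + (n + 1)) u"
    by simp
  from dvd_add[OF this Suc.IH[of "c + (n + 1)"]] show ?case
    by (simp add: algebra_simps)
qed simp

lemma rel_poly_dvd_section:
  "(rel_poly n :: 'k::field poly3) dvd
     Poly_Mapping.single m u - Poly_Mapping.single (toric_section n (toric_exp n m)) u"
proof -
  obtain a b c where m: "m = (a, b, c)" by (cases m)
  show ?thesis
  proof (cases "b \<le> a")
    case True
    then have "toric_section n (toric_exp n m) = (a - b, 0, c + b * (n + 1))"
      by (auto simp: m toric_exp_def toric_section_def algebra_simps nat_eq_iff)
    then show ?thesis
      using rel_poly_dvd_monom[of n "a - b" b 0 c u] True by (simp add: m)
  next
    case False
    then have "toric_section n (toric_exp n m) = (0, b - a, c + a * (n + 1))"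
      by (auto simp: m toric_exp_def toric_section_def algebra_simps nat_eq_iff)
    then show ?thesis
      using rel_poly_dvd_monom[of n 0 a "b - a" c u] False by (simp add: m)
  qed
qed

text \<open>
  There is a surjective homomorphism of \<open>k\<close>-algebras \<open>k[x,y,z] \<rightarrow> A\<^sub>n\<close> whose kernel is the ideal
  generated by \<open>xy - z\<^sup>n\<^sup>+\<^sup>1\<close>.
\<close>

theorem A_n_presentation:
  obtains \<phi> :: "'k::field poly3 \<Rightarrow> (int \<times> int) \<Rightarrow>\<^sub>0 'k"
  where "\<And>p q. \<phi> (p + q) = \<phi> p + \<phi> q"
    and "\<And>p q. \<phi> (p * q) = \<phi> p * \<phi> q"
    and "\<phi> 1 = 1"
    and "\<And>c p. \<phi> (pm_scale c p) = pm_scale c (\<phi> p)"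
    and "\<phi> var_x = Poly_Mapping.single (0, 1) 1"
    and "\<phi> var_y = Poly_Mapping.single (int n + 1, int n) 1"
    and "\<phi> var_z = Poly_Mapping.single (1, 1) 1"
    and "range \<phi> = A_n n"
    and "{p. \<phi> p = 0} = {p. var_x * var_y - var_z ^ (n + 1) dvd p}"
proof
  let ?\<phi> = "push (toric_exp n) :: 'k poly3 \<Rightarrow> _"
  have e0: "toric_exp n 0 = 0" by (simp add: toric_exp_def zero_prod_def)
  show mult: "?\<phi> (p * q) = ?\<phi> p * ?\<phi> q" for p q
    by (rule push_mult) (rule toric_exp_add)
  show "?\<phi> (p + q) = ?\<phi> p + ?\<phi> q" for p q
    by (rule push_add)
  show "?\<phi> 1 = 1"
    using push_single[of "toric_exp n" 0 "1::'k"] by (simp add: e0)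
  show "?\<phi> (pm_scale c p) = pm_scale c (?\<phi> p)" for c p
    by (simp add: pm_scale_conv_mult mult e0)
  show "?\<phi> var_x = Poly_Mapping.single (0, 1) 1"
    "?\<phi> var_y = Poly_Mapping.single (int n + 1, int n) 1"
    "?\<phi> var_z = Poly_Mapping.single (1, 1) 1"
    by (simp_all add: var_x_def var_y_def var_z_def toric_exp_def)
  show "range ?\<phi> = A_n n"
  proof
    show "range ?\<phi> \<subseteq> A_n n"
    proof
      fix q assume "q \<in> range ?\<phi>"
      then obtain p where q: "q = ?\<phi> p" by blast
      show "q \<in> A_n n"
        unfolding q push_def
        by (rule A_n.subspace_sum[OF A_n.subspace_A])
          (auto simp: A_n_def toric_exp_in_Lambda)
    qed
    show "A_n n \<subseteq> range ?\<phi>"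
    proof
      fix q :: "(int \<times> int) \<Rightarrow>\<^sub>0 'k" assume q: "q \<in> A_n n"
      let ?s = "inv_into UNIV (toric_exp n)"
      have "?\<phi> (push ?s q) = push (toric_exp n \<circ> ?s) q"
        by (rule push_push)
      also have "\<dots> = push (\<lambda>m. m) q"
        unfolding push_def
      proof (rule sum.cong)
        fix v assume "v \<in> Poly_Mapping.keys q"
        then have "v \<in> range (toric_exp n)"
          using q by (auto simp: A_n_def Lambda_eq_range)
        then show "Poly_Mapping.single ((toric_exp n \<circ> ?s) v) (Poly_Mapping.lookup q v)
            = Poly_Mapping.single v (Poly_Mapping.lookup q v)"
          by (simp add: f_inv_into_f)
      qed simp
      finally show "q \<in> range ?\<phi>"
        by (metis push_id rangeI)
    qed
  qed
  show "{p. ?\<phi> p = 0} = {p. var_x * var_y - var_z ^ (n + 1) dvd p}"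
    unfolding rel_poly_def[symmetric]
  proof (rule Collect_cong, rule iffI)
    fix p :: "'k poly3" assume "?\<phi> p = 0"
    then have z: "push (toric_section n \<circ> toric_exp n) p = 0"
      by (metis push_push push_zero)
    have "p - push (toric_section n \<circ> toric_exp n) p
        = (\<Sum>m\<in>Poly_Mapping.keys p. Poly_Mapping.single m (Poly_Mapping.lookup p m)
            - Poly_Mapping.single (toric_section n (toric_exp n m)) (Poly_Mapping.lookup p m))"
      using push_id[of p] by (simp add: push_def sum_subtractf)
    also have "rel_poly n dvd \<dots>"
      by (intro dvd_sum rel_poly_dvd_section)
    finally show "rel_poly n dvd p" by (simp add: z)
  next
    fix p :: "'k poly3" assume "rel_poly n dvd p"
    then obtain r where "p = rel_poly n * r" by (elim dvdE)
    moreover have "?\<phi> (rel_poly n) = 0"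
    proof -
      have "?\<phi> (rel_poly n) + ?\<phi> (Poly_Mapping.single (0, 0, n + 1) 1)
          = ?\<phi> (Poly_Mapping.single (1, 1, 0) 1)"
        unfolding rel_poly_eq push_add[symmetric] by simp
      then show ?thesis by (simp add: toric_exp_def algebra_simps)
    qed
    ultimately show "?\<phi> p = 0" by (simp add: mult)
  qed
qed

end

theory Submission
  imports Defs
begin

text \<open>
  Write \<open>x\<close>, \<open>z\<close>, \<open>y\<close> for the monomials with exponents \<open>S\<^sub>1 = (0, 1)\<close>, \<open>S\<^sub>2 = (1, 1)\<close>,
  \<open>S\<^sub>3 = (n + 1, n)\<close>, so that \<open>x y = z\<^sup>n\<^sup>+\<^sup>1\<close>. The bracket is bilinear and symmetric in degree 2, and the
  bracket of a coboundary with a cocycle is a coboundary. It therefore suffices to know a set of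
  cocycles that spans the second cohomology and whose mutual brackets are coboundaries.
  
  Up to equivalence, first order deformations of \<open>A\<^sub>n\<close> are sums of deformations of two kinds. The first
  is the commutative deformation \<open>x y = z\<^sup>n\<^sup>+\<^sup>1 + t z\<^sup>i\<close> of the surface. On monomials its cocycle counts
  the factors \<open>x y\<close> that have to be rewritten in a product (\<open>carry\<close>). The second is a Poisson bracket.
  In the invariant coordinates \<open>u\<close>, \<open>w\<close> with \<open>x = w\<^sup>n\<^sup>+\<^sup>1\<close>, \<open>y = u\<^sup>n\<^sup>+\<^sup>1\<close>, \<open>z = u w\<close> it is a multiple
  \<open>h \<partial>\<^sub>u \<and> \<partial>\<^sub>w\<close> of the standard bracket with \<open>h \<in> A\<^sub>n\<close>, and on monomials it is a determinant of
  exponents (\<open>omega\<close>). That these span is \<open>cocycle_cohomologous_basic_span\<close>. The antisymmetric part of a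
  cocycle is a biderivation, hence a biadditive alternating function of exponents once the values are
  divided by monomials, hence a multiple of the determinant. The symmetric part is a commutative
  extension of the monoid \<open>\<Lambda>\<^sub>n\<close>. Such an extension is determined by lifts of \<open>x\<close>, \<open>y\<close>, \<open>z\<close> and by the
  defect of the single relation \<open>x y = z\<^sup>n\<^sup>+\<^sup>1\<close>. Changing the lifts of \<open>x\<close> and \<open>y\<close> changes the defect by
  an element of the ideal \<open>(x, y)\<close>, and what remains is a polynomial in \<open>z\<close>.
  
  Each of the three kinds of brackets vanishes because a deformation goes on. The commutative
  deformations extend to all orders in \<open>t\<close>, and the second order term of a power of \<open>z\<^sup>n\<^sup>+\<^sup>1 + t g(z)\<close> is
  the primitive of the bracket of two of them (\<open>bracket_carry_carry\<close>). A Poisson bracket on the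
  \<open>(u, w)\<close>-plane has a star product, whose second order term is the primitive for two Poisson brackets
  (\<open>bracket_omega_omega\<close>). Finally the Poisson bracket \<open>h \<partial>\<^sub>u \<and> \<partial>\<^sub>w\<close> extends to the deformed surfaces,
  and the first order term of this extension is the primitive in the mixed case
  (\<open>bracket_carry_omega\<close>).
  
  All these operators are defined on the whole group algebra \<open>k[\<int>\<^sup>2]\<close>. They send a pair of monomials to
  an integer multiple of a shift of their product, so that the claims about primitives become
  identities between integer functions on \<open>\<int>\<^sup>2\<close>. What depends on the cone is only that the operators
  map \<open>A\<^sub>n \<times> A\<^sub>n\<close> into \<open>A\<^sub>n\<close>, that is, that their coefficients vanish whenever the shifted product
  leaves the cone.
\<close>


section \<open>The Gerstenhaber bracket of bilinear 2-cochains\<close>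

context k_algebra
begin

lemma A_closed [simp, intro]:
  shows "0 \<in> A" "a \<in> A \<Longrightarrow> b \<in> A \<Longrightarrow> a + b \<in> A" "a \<in> A \<Longrightarrow> b \<in> A \<Longrightarrow> a - b \<in> A"
    "a \<in> A \<Longrightarrow> - a \<in> A" "a \<in> A \<Longrightarrow> c *s a \<in> A" "a \<in> A \<Longrightarrow> b \<in> A \<Longrightarrow> a * b \<in> A"
  using subspace_A
  by (auto simp: subspace_0 subspace_add subspace_diff subspace_neg subspace_scale mult_A)

text \<open>
  The 2-cochains below are functions of two arguments instead of functions of lists. Linearity refers
  to \<open>A\<close> only, since a cochain is given by its values there.
\<close>

definition linear_op :: "('a \<Rightarrow> 'a) \<Rightarrow> bool" where
  "linear_op \<phi> \<longleftrightarrow> (\<forall>a\<in>A. \<phi> a \<in> A) \<and> (\<forall>a\<in>A. \<forall>b\<in>A. \<forall>c. \<phi> (c *s a + b) = c *s \<phi> a + \<phi> b)"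

definition bilinear_op :: "('a \<Rightarrow> 'a \<Rightarrow> 'a) \<Rightarrow> bool" where
  "bilinear_op f \<longleftrightarrow> (\<forall>b\<in>A. linear_op (\<lambda>a. f a b)) \<and> (\<forall>a\<in>A. linear_op (f a))"

definition delta1 :: "('a \<Rightarrow> 'a) \<Rightarrow> 'a \<Rightarrow> 'a \<Rightarrow> 'a" where
  "delta1 \<phi> a b = a * \<phi> b - \<phi> (a * b) + \<phi> a * b"

definition delta2 :: "('a \<Rightarrow> 'a \<Rightarrow> 'a) \<Rightarrow> 'a \<Rightarrow> 'a \<Rightarrow> 'a \<Rightarrow> 'a" where
  "delta2 f a b c = a * f b c - f (a * b) c + f a (b * c) - f a b * c"

definition cocycle2 :: "('a \<Rightarrow> 'a \<Rightarrow> 'a) \<Rightarrow> bool" where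
  "cocycle2 f \<longleftrightarrow> bilinear_op f \<and> (\<forall>a\<in>A. \<forall>b\<in>A. \<forall>c\<in>A. delta2 f a b c = 0)"

definition bracket :: "('a \<Rightarrow> 'a \<Rightarrow> 'a) \<Rightarrow> ('a \<Rightarrow> 'a \<Rightarrow> 'a) \<Rightarrow> 'a \<Rightarrow> 'a \<Rightarrow> 'a \<Rightarrow> 'a" where
  "bracket f g a b c = f (g a b) c - f a (g b c) + g (f a b) c - g a (f b c)"

text \<open>
  The relation that is proved for all pairs of cocycles: the bracket is a coboundary.
\<close>

definition bracket_exact :: "('a \<Rightarrow> 'a \<Rightarrow> 'a) \<Rightarrow> ('a \<Rightarrow> 'a \<Rightarrow> 'a) \<Rightarrow> bool" where
  "bracket_exact f g \<longleftrightarrow>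
     (\<exists>H. bilinear_op H \<and> (\<forall>a\<in>A. \<forall>b\<in>A. \<forall>c\<in>A. bracket f g a b c = delta2 H a b c))"

lemma linear_op_closed: "linear_op \<phi> \<Longrightarrow> a \<in> A \<Longrightarrow> \<phi> a \<in> A"
  by (simp add: linear_op_def)

lemma linear_op_comb: "linear_op \<phi> \<Longrightarrow> a \<in> A \<Longrightarrow> b \<in> A \<Longrightarrow> \<phi> (c *s a + b) = c *s \<phi> a + \<phi> b"
  by (simp add: linear_op_def)

lemma linear_op_add: "linear_op \<phi> \<Longrightarrow> a \<in> A \<Longrightarrow> b \<in> A \<Longrightarrow> \<phi> (a + b) = \<phi> a + \<phi> b"
  using linear_op_comb[of \<phi> a b 1] by simp

lemma linear_op_zero: "linear_op \<phi> \<Longrightarrow> \<phi> 0 = 0"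
  using linear_op_add[of \<phi> 0 0] by simp

lemma linear_op_scale: "linear_op \<phi> \<Longrightarrow> a \<in> A \<Longrightarrow> \<phi> (c *s a) = c *s \<phi> a"
  using linear_op_comb[of \<phi> a 0 c] by (simp add: linear_op_zero)

lemma linear_op_minus: "linear_op \<phi> \<Longrightarrow> a \<in> A \<Longrightarrow> \<phi> (- a) = - \<phi> a"
  using linear_op_scale[of \<phi> a "-1"] by simp

lemma linear_op_diff: "linear_op \<phi> \<Longrightarrow> a \<in> A \<Longrightarrow> b \<in> A \<Longrightarrow> \<phi> (a - b) = \<phi> a - \<phi> b"
  using linear_op_add[of \<phi> a "- b"] by (simp add: linear_op_minus)

lemma bilinear_op_slots:
  assumes "bilinear_op f"
  shows "b \<in> A \<Longrightarrow> linear_op (\<lambda>a. f a b)" "a \<in> A \<Longrightarrow> linear_op (f a)"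
  using assms by (auto simp: bilinear_op_def)

lemma bilinear_op_closed: "bilinear_op f \<Longrightarrow> a \<in> A \<Longrightarrow> b \<in> A \<Longrightarrow> f a b \<in> A"
  by (metis linear_op_closed bilinear_op_slots(2))

lemma bilinear_op_add:
  assumes "bilinear_op f" "a \<in> A" "a' \<in> A" "b \<in> A"
  shows "f (a + a') b = f a b + f a' b" "f b (a + a') = f b a + f b a'"
  using linear_op_add[OF bilinear_op_slots(1)[OF assms(1,4)] assms(2,3)]
    linear_op_add[OF bilinear_op_slots(2)[OF assms(1,4)] assms(2,3)] by simp_all

lemma bilinear_op_diff:
  assumes "bilinear_op f" "a \<in> A" "a' \<in> A" "b \<in> A"
  shows "f (a - a') b = f a b - f a' b" "f b (a - a') = f b a - f b a'"
  using linear_op_diff[OF bilinear_op_slots(1)[OF assms(1,4)] assms(2,3)]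
    linear_op_diff[OF bilinear_op_slots(2)[OF assms(1,4)] assms(2,3)] by simp_all

lemma bilinear_op_scale:
  assumes "bilinear_op f" "a \<in> A" "b \<in> A"
  shows "f (c *s a) b = c *s f a b" "f b (c *s a) = c *s f b a"
  using linear_op_scale[OF bilinear_op_slots(1)[OF assms(1,3)] assms(2)]
    linear_op_scale[OF bilinear_op_slots(2)[OF assms(1,3)] assms(2)] by simp_all

lemma linear_op_comp_diff: "linear_op \<phi> \<Longrightarrow> linear_op \<psi> \<Longrightarrow> linear_op (\<lambda>a. \<phi> a - \<psi> a)"
  by (auto simp: linear_op_def scale_right_diff_distrib)

lemma linear_op_sum: "linear_op \<phi> \<Longrightarrow> linear_op \<psi> \<Longrightarrow> linear_op (\<lambda>a. \<phi> a + \<psi> a)"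
  by (auto simp: linear_op_def scale_right_distrib)

lemma linear_op_mult_scalar: "linear_op \<phi> \<Longrightarrow> linear_op (\<lambda>a. c *s \<phi> a)"
  by (auto simp: linear_op_def scale_right_distrib mult.commute)

lemma bilinear_op_sum: "bilinear_op f \<Longrightarrow> bilinear_op g \<Longrightarrow> bilinear_op (\<lambda>a b. f a b + g a b)"
  by (auto simp: bilinear_op_def intro: linear_op_sum)

lemma bilinear_op_mult_scalar: "bilinear_op f \<Longrightarrow> bilinear_op (\<lambda>a b. c *s f a b)"
  by (auto simp: bilinear_op_def intro: linear_op_mult_scalar)

lemma bilinear_op_zero: "bilinear_op (\<lambda>a b. 0)"
  by (auto simp: bilinear_op_def linear_op_def)

lemma bracket_exact_sym: "bracket_exact f g \<Longrightarrow> bracket_exact g f"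
proof -
  have "bracket g f a b c = bracket f g a b c" for a b c
    by (simp add: bracket_def)
  then show "bracket_exact f g \<Longrightarrow> bracket_exact g f" by (simp add: bracket_exact_def)
qed

lemma bracket_exact_zero:
  assumes "bilinear_op g"
  shows "bracket_exact (\<lambda>a b. 0) g"
  unfolding bracket_exact_def
proof (intro exI conjI ballI)
  show "bilinear_op (\<lambda>a b. 0)" by (rule bilinear_op_zero)
  show "bracket (\<lambda>a b. 0) g a b c = delta2 (\<lambda>a b. 0) a b c" if "a \<in> A" "b \<in> A" "c \<in> A" for a b c
    using that assms by (simp add: bracket_def delta2_def linear_op_zero[OF bilinear_op_slots(1)] linear_op_zero[OF bilinear_op_slots(2)])
qed

lemma bracket_exact_lincomb:
  assumes "bilinear_op f" "bilinear_op f'" "bilinear_op g" "bracket_exact f g" "bracket_exact f' g"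
  shows "bracket_exact (\<lambda>a b. f a b + c *s f' a b) g"
proof -
  obtain H where H: "bilinear_op H" "\<And>a b c. \<lbrakk>a \<in> A; b \<in> A; c \<in> A\<rbrakk> \<Longrightarrow> bracket f g a b c = delta2 H a b c"
    using assms(4) by (auto simp: bracket_exact_def)
  obtain H' where H': "bilinear_op H'"
      "\<And>a b c. \<lbrakk>a \<in> A; b \<in> A; c \<in> A\<rbrakk> \<Longrightarrow> bracket f' g a b c = delta2 H' a b c"
    using assms(5) by (auto simp: bracket_exact_def)
  show ?thesis
    unfolding bracket_exact_def
  proof (intro exI[of _ "\<lambda>a b. H a b + c *s H' a b"] conjI ballI)
    show "bilinear_op (\<lambda>a b. H a b + c *s H' a b)"
      using H(1) H'(1) by (intro bilinear_op_sum bilinear_op_mult_scalar)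
    fix x y z assume A: "x \<in> A" "y \<in> A" "z \<in> A"
    have "bracket (\<lambda>a b. f a b + c *s f' a b) g x y z
        = bracket f g x y z + c *s bracket f' g x y z"
      using A assms(1-3)
      by (simp add: bracket_def bilinear_op_add bilinear_op_scale bilinear_op_closed
          scale_right_distrib scale_right_diff_distrib)
    also have "\<dots> = delta2 H x y z + c *s delta2 H' x y z"
      using A by (simp add: H(2) H'(2))
    also have "\<dots> = delta2 (\<lambda>a b. H a b + c *s H' a b) x y z"
      using A H(1) H'(1)
      by (simp add: delta2_def bilinear_op_closed scale_right_distrib scale_right_diff_distrib
          scale_mult_left scale_mult_right algebra_simps)
    finally show "bracket (\<lambda>a b. f a b + c *s f' a b) g x y z
        = delta2 (\<lambda>a b. H a b + c *s H' a b) x y z" .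
  qed
qed

lemma bracket_exact_cong:
  assumes "bilinear_op g" "bilinear_op f" "\<And>a b. a \<in> A \<Longrightarrow> b \<in> A \<Longrightarrow> f' a b = f a b" "bracket_exact f g"
  shows "bracket_exact f' g"
proof -
  have "bracket f' g a b c = bracket f g a b c" if "a \<in> A" "b \<in> A" "c \<in> A" for a b c
    using that assms(1-3) by (simp add: bracket_def bilinear_op_closed)
  then show ?thesis using assms(4) by (simp add: bracket_exact_def)
qed

text \<open>
  By trilinearity it suffices to compare a bracket and a coboundary on a spanning set.
\<close>

lemma linear_op_bracket_diff_delta2:
  assumes f: "bilinear_op f" and g: "bilinear_op g" and H: "bilinear_op H"
  defines "t \<equiv> \<lambda>a b c. bracket f g a b c - delta2 H a b c"
  shows "b \<in> A \<Longrightarrow> c \<in> A \<Longrightarrow> linear_op (\<lambda>a. t a b c)"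
    and "a \<in> A \<Longrightarrow> c \<in> A \<Longrightarrow> linear_op (\<lambda>b. t a b c)"
    and "a \<in> A \<Longrightarrow> b \<in> A \<Longrightarrow> linear_op (t a b)"
  unfolding t_def bracket_def delta2_def linear_op_def
  by (simp_all add: bilinear_op_closed[OF f] bilinear_op_closed[OF g] bilinear_op_closed[OF H]
      bilinear_op_add[OF f] bilinear_op_add[OF g] bilinear_op_add[OF H]
      bilinear_op_scale[OF f] bilinear_op_scale[OF g] bilinear_op_scale[OF H]
      scale_right_distrib scale_right_diff_distrib scale_mult_left scale_mult_right
      distrib_left distrib_right)

lemma bilinear_op_delta1:
  assumes "linear_op \<phi>"
  shows "bilinear_op (delta1 \<phi>)"
  using assms
  by (auto simp: bilinear_op_def linear_op_def delta1_def distrib_left distrib_right scale_right_distrib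
      scale_right_diff_distrib scale_mult_left scale_mult_right)

lemma cocycle2_delta1:
  assumes "linear_op \<phi>"
  shows "cocycle2 (delta1 \<phi>)"
  unfolding cocycle2_def
proof (intro conjI ballI bilinear_op_delta1 assms)
  show "delta2 (delta1 \<phi>) a b c = 0" if "a \<in> A" "b \<in> A" "c \<in> A" for a b c
    by (simp add: delta2_def delta1_def algebra_simps)
qed

text \<open>
  The primitive is the bracket of \<open>\<phi>\<close> and \<open>g\<close>, up to sign. In the difference of the two sides all terms
  are values of the cocycle equation of \<open>g\<close>, either with \<open>\<phi>\<close> applied to one of its arguments or with \<open>\<phi>\<close>
  applied to the whole equation.
\<close>

lemma bracket_exact_delta1:
  assumes \<phi>: "linear_op \<phi>" and g: "cocycle2 g"
  shows "bracket_exact (delta1 \<phi>) g"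
  unfolding bracket_exact_def
proof (intro exI[of _ "\<lambda>a b. g (\<phi> a) b + g a (\<phi> b) - \<phi> (g a b)"] conjI ballI)
  have lg: "bilinear_op g" using g by (simp add: cocycle2_def)
  note cl = linear_op_closed[OF \<phi>] bilinear_op_closed[OF lg]
  show "bilinear_op (\<lambda>a b. g (\<phi> a) b + g a (\<phi> b) - \<phi> (g a b))"
    using cl
    by (auto simp: bilinear_op_def linear_op_def linear_op_add[OF \<phi>] linear_op_scale[OF \<phi>] bilinear_op_add[OF lg]
        bilinear_op_scale[OF lg] scale_right_distrib scale_right_diff_distrib)
  fix a b c assume A: "a \<in> A" "b \<in> A" "c \<in> A"
  have coc: "x * g y z - g (x * y) z + g x (y * z) - g x y * z = 0" if "x \<in> A" "y \<in> A" "z \<in> A" for x y z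
    using g that by (simp add: cocycle2_def delta2_def)
  have 1: "\<phi> (a * g b c) - \<phi> (g (a * b) c) + \<phi> (g a (b * c)) - \<phi> (g a b * c) = 0"
    using arg_cong[OF coc[OF A], of \<phi>] A cl
    by (simp add: linear_op_add[OF \<phi>] linear_op_diff[OF \<phi>] linear_op_zero[OF \<phi>])
  have "bracket (delta1 \<phi>) g a b c - delta2 (\<lambda>a b. g (\<phi> a) b + g a (\<phi> b) - \<phi> (g a b)) a b c
      = (\<phi> (a * g b c) - \<phi> (g (a * b) c) + \<phi> (g a (b * c)) - \<phi> (g a b * c))
        - (\<phi> a * g b c - g (\<phi> a * b) c + g (\<phi> a) (b * c) - g (\<phi> a) b * c)
        - (a * g (\<phi> b) c - g (a * \<phi> b) c + g a (\<phi> b * c) - g a (\<phi> b) * c)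
        - (a * g b (\<phi> c) - g (a * b) (\<phi> c) + g a (b * \<phi> c) - g a b * \<phi> c)"
    using A cl
    by (simp add: bracket_def delta2_def delta1_def bilinear_op_add[OF lg] bilinear_op_diff[OF lg] algebra_simps)
  also have "\<dots> = 0"
    using A cl by (simp add: 1 coc)
  finally show "bracket (delta1 \<phi>) g a b c
      = delta2 (\<lambda>a b. g (\<phi> a) b + g a (\<phi> b) - \<phi> (g a b)) a b c"
    by simp
qed

lemma tuples2: "xs \<in> tuples 2 \<longleftrightarrow> (\<exists>a\<in>A. \<exists>b\<in>A. xs = [a, b])"
  by (auto simp: tuples_def numeral_2_eq_2 length_Suc_conv)

lemma tuples3: "xs \<in> tuples 3 \<longleftrightarrow> (\<exists>a\<in>A. \<exists>b\<in>A. \<exists>c\<in>A. xs = [a, b, c])"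
  by (auto simp: tuples_def numeral_3_eq_3 length_Suc_conv)

lemma bilinear_op_cochain:
  assumes "f \<in> cochains 2"
  shows "bilinear_op (\<lambda>a b. f [a, b])"
proof -
  have lin: "f (xs @ (c *s a + b) # ys) = c *s f (xs @ a # ys) + f (xs @ b # ys)"
    if "xs @ a # ys \<in> tuples 2" "b \<in> A" for xs ys a b c
    using assms that by (simp add: cochains_def)
  show ?thesis
    using assms lin[of "[]" _ "[_]"] lin[of "[_]" _ "[]"]
    by (auto simp: bilinear_op_def linear_op_def tuples2 cochains_def)
qed

lemma coboundary_2:
  "coboundary 2 f xs = (if xs \<in> tuples 3 then
     delta2 (\<lambda>a b. f [a, b]) (xs ! 0) (xs ! 1) (xs ! 2) else 0)"
proof (cases "xs \<in> tuples 3")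
  case True
  then obtain a b c where "xs = [a, b, c]" by (auto simp: tuples3)
  with True show ?thesis
    by (simp add: coboundary_def delta2_def eval_nat_numeral lessThan_Suc)
qed (simp add: coboundary_def eval_nat_numeral)

lemma coboundary_1:
  "coboundary 1 f xs = (if xs \<in> tuples 2 then delta1 (\<lambda>a. f [a]) (xs ! 0) (xs ! 1) else 0)"
proof (cases "xs \<in> tuples 2")
  case True
  then obtain a b where "xs = [a, b]" by (auto simp: tuples2)
  with True show ?thesis
    by (simp add: coboundary_def delta1_def eval_nat_numeral lessThan_Suc)
qed (simp add: coboundary_def eval_nat_numeral)

lemma cocycle2_cocycle_group:
  assumes "f \<in> carrier (cocycle_group 2)"
  shows "cocycle2 (\<lambda>a b. f [a, b])"
proof -
  have f: "f \<in> cochains 2" and k: "coboundary 2 f = (\<lambda>xs. 0)"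
    using assms by (auto simp: cocycle_group_def kernel_def cochain_group_def)
  have "delta2 (\<lambda>a b. f [a, b]) a b c = 0" if "a \<in> A" "b \<in> A" "c \<in> A" for a b c
    using fun_cong[OF k, of "[a, b, c]"] that by (simp add: coboundary_2 tuples3)
  then show ?thesis by (simp add: cocycle2_def bilinear_op_cochain[OF f])
qed

lemma cocycle_groupI:
  assumes "f \<in> cochains 2" "\<And>a b c. \<lbrakk>a \<in> A; b \<in> A; c \<in> A\<rbrakk> \<Longrightarrow> delta2 (\<lambda>a b. f [a, b]) a b c = 0"
  shows "f \<in> carrier (cocycle_group 2)"
proof -
  have "coboundary 2 f xs = 0" for xs
    using assms(2) by (auto simp: coboundary_2 tuples3)
  then show ?thesis
    using assms(1) by (auto simp: cocycle_group_def kernel_def cochain_group_def)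
qed

lemma bilinear_op_to_cochain:
  assumes "bilinear_op H"
  shows "(\<lambda>xs. if xs \<in> tuples 2 then H (xs ! 0) (xs ! 1) else 0) \<in> cochains 2"
  unfolding cochains_def mem_Collect_eq
proof (intro conjI allI impI ballI)
  show "(if xs \<in> tuples 2 then H (xs ! 0) (xs ! 1) else 0) \<in> A" for xs
    using assms by (auto simp: tuples2 bilinear_op_closed)
  fix xs ys a b c assume t: "xs @ a # ys \<in> tuples 2" and b: "b \<in> A"
  from t obtain u v where uv: "xs @ a # ys = [u, v]" "u \<in> A" "v \<in> A" by (auto simp: tuples2)
  then consider "xs = []" "a = u" "ys = [v]" | "xs = [u]" "a = v" "ys = []"
    by (auto simp: append_eq_Cons_conv)
  then show "(if xs @ (c *s a + b) # ys \<in> tuples 2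
        then H ((xs @ (c *s a + b) # ys) ! 0) ((xs @ (c *s a + b) # ys) ! 1) else 0)
      = c *s (if xs @ a # ys \<in> tuples 2 then H ((xs @ a # ys) ! 0) ((xs @ a # ys) ! 1) else 0)
      + (if xs @ b # ys \<in> tuples 2 then H ((xs @ b # ys) ! 0) ((xs @ b # ys) ! 1) else 0)"
    using uv b by cases (auto simp: tuples2 bilinear_op_add[OF assms] bilinear_op_scale[OF assms])
qed simp

lemma gerstenhaber_bracket_2_2:
  "gerstenhaber_bracket 2 2 f g xs = (if xs \<in> tuples 3 then
     bracket (\<lambda>a b. f [a, b]) (\<lambda>a b. g [a, b]) (xs ! 0) (xs ! 1) (xs ! 2) else 0)"
proof (cases "xs \<in> tuples 3")
  case True
  then obtain a b c where "xs = [a, b, c]" by (auto simp: tuples3)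
  with True show ?thesis
    by (simp add: gerstenhaber_bracket_def circ_def bracket_def eval_nat_numeral lessThan_Suc)
qed (simp add: gerstenhaber_bracket_def circ_def eval_nat_numeral)

lemma gerstenhaber_bracket_coboundary:
  assumes "bracket_exact (\<lambda>a b. f [a, b]) (\<lambda>a b. g [a, b])"
  shows "gerstenhaber_bracket 2 2 f g \<in> coboundaries 3"
proof -
  obtain H where H: "bilinear_op H" "\<And>a b c. \<lbrakk>a \<in> A; b \<in> A; c \<in> A\<rbrakk> \<Longrightarrow>
      bracket (\<lambda>a b. f [a, b]) (\<lambda>a b. g [a, b]) a b c = delta2 H a b c"
    using assms by (auto simp: bracket_exact_def)
  let ?H = "\<lambda>xs. if xs \<in> tuples 2 then H (xs ! 0) (xs ! 1) else 0"
  have "gerstenhaber_bracket 2 2 f g xs = coboundary 2 ?H xs" for xs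
    by (auto simp: gerstenhaber_bracket_2_2 coboundary_2 tuples3 H(2) delta2_def tuples2)
  then have "gerstenhaber_bracket 2 2 f g = coboundary 2 ?H" by blast
  moreover have "coboundaries 3 = coboundary 2 ` cochains 2"
    by (simp add: coboundaries_def eval_nat_numeral)
  ultimately show ?thesis
    using bilinear_op_to_cochain[OF H(1)] by simp
qed

lemma coboundaries_2_cocycles:
  assumes "f \<in> coboundaries 2" 
  shows "f \<in> carrier (cocycle_group 2)"
proof -
  have "coboundaries 2 = coboundary 1 ` cochains 1"
    by (simp add: coboundaries_def eval_nat_numeral)
  then obtain h where h: "h \<in> cochains 1" "f = coboundary 1 h"
    using assms by auto
  have "linear_op (\<lambda>a. h [a])"
    unfolding linear_op_def
  proof (intro conjI ballI allI)
    have t: "[a] \<in> tuples 1" if "a \<in> A" for a using that by (simp add: tuples_def)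
    show "h [a] \<in> A" if "a \<in> A" for a using h(1) t[OF that] by (simp add: cochains_def)
    show "h [c *s a + b] = c *s h [a] + h [b]" if "a \<in> A" "b \<in> A" for a b c
    proof -
      have "\<forall>xs ys a b c. xs @ a # ys \<in> tuples 1 \<longrightarrow> b \<in> A \<longrightarrow>
          h (xs @ (c *s a + b) # ys) = c *s h (xs @ a # ys) + h (xs @ b # ys)"
        using h(1) by (simp add: cochains_def)
      from this[rule_format, of "[]" a "[]" b c] show ?thesis using that t by simp
    qed
  qed
  note coc = cocycle2_delta1[OF this]
  have f: "f = (\<lambda>xs. if xs \<in> tuples 2 then delta1 (\<lambda>a. h [a]) (xs ! 0) (xs ! 1) else 0)"
    using h(2) coboundary_1 by auto
  show ?thesis
  proof (rule cocycle_groupI)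
    show "f \<in> cochains 2"
      unfolding f using coc by (intro bilinear_op_to_cochain) (simp add: cocycle2_def)
    show "delta2 (\<lambda>a b. f [a, b]) a b c = 0" if "a \<in> A" "b \<in> A" "c \<in> A" for a b c
      using coc that by (simp add: f cocycle2_def delta2_def tuples2)
  qed
qed

lemma HH2_class_cocycles:
  assumes "X \<in> carrier (HH 2)"
  shows "X \<noteq> {}" "X \<subseteq> carrier (cocycle_group 2)"
proof -
  obtain f where f: "f \<in> carrier (cocycle_group 2)" "X = coboundaries 2 #>\<^bsub>cocycle_group 2\<^esub> f"
    using assms by (auto simp: HH_def FactGroup_def RCOSETS_def)
  have cf: "f \<in> cochains 2" 
    using f by (auto simp: cocycle_group_def kernel_def cochain_group_def)
  have X: "X = (\<lambda>g xs. g xs + f xs) ` coboundaries 2"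
    by (auto simp: f(2) r_coset_def cocycle_group_def cochain_group_def)
  show "X \<subseteq> carrier (cocycle_group 2)"
    unfolding X
  proof (intro image_subsetI)
    fix g assume "g \<in> coboundaries 2"
    then have g: "g \<in> carrier (cocycle_group 2)" by (rule coboundaries_2_cocycles)
    then have cg: "g \<in> cochains 2"
      by (auto simp: cocycle_group_def kernel_def cochain_group_def)
    show "(\<lambda>xs. g xs + f xs) \<in> carrier (cocycle_group 2)"
    proof (rule cocycle_groupI)
      show "(\<lambda>xs. g xs + f xs) \<in> cochains 2"
        using cf cg by (auto simp: cochains_def scale_right_distrib)
      show "delta2 (\<lambda>a b. g [a, b] + f [a, b]) a b c = 0" if "a \<in> A" "b \<in> A" "c \<in> A" for a b c
        using cocycle2_cocycle_group[OF f(1)] cocycle2_cocycle_group[OF g] that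
        by (simp add: cocycle2_def delta2_def algebra_simps)
    qed
  qed
  have "(\<lambda>xs. 0) \<in> cochains 1" by (auto simp: cochains_def)
  then have "coboundaries 2 \<noteq> {}" by (auto simp: coboundaries_def eval_nat_numeral)
  then show "X \<noteq> {}" by (simp add: X)
qed

lemma coboundaries_3_coset:
  assumes "f \<in> coboundaries 3"
  shows "coboundaries 3 #>\<^bsub>cocycle_group 3\<^esub> f = coboundaries 3"
proof -
  have cob: "coboundaries 3 = coboundary 2 ` cochains 2"
    by (simp add: coboundaries_def eval_nat_numeral)
  obtain F where F: "F \<in> cochains 2" "f = coboundary 2 F" using assms by (auto simp: cob)
  have comb: "(\<lambda>xs. g xs + c *s f xs) \<in> coboundaries 3" if g: "g \<in> coboundaries 3" for g c
  proof -
    obtain G where G: "G \<in> cochains 2" "g = coboundary 2 G" using g by (auto simp: cob)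
    have "(\<lambda>xs. G xs + c *s F xs) \<in> cochains 2"
      using G(1) F(1) by (auto simp: cochains_def scale_right_distrib mult.commute)
    moreover have "g xs + c *s f xs = coboundary 2 (\<lambda>xs. G xs + c *s F xs) xs" for xs
      using bilinear_op_closed[OF bilinear_op_cochain[OF F(1)]]
      by (auto simp: G(2) F(2) coboundary_2 tuples3 delta2_def scale_right_distrib
          scale_right_diff_distrib scale_mult_left scale_mult_right algebra_simps)
    ultimately show ?thesis by (auto simp: cob image_iff)
  qed
  have "coboundaries 3 #>\<^bsub>cocycle_group 3\<^esub> f = (\<lambda>g xs. g xs + f xs) ` coboundaries 3"
    by (auto simp: r_coset_def cocycle_group_def cochain_group_def)
  also have "\<dots> = coboundaries 3"
  proof
    show "(\<lambda>g xs. g xs + f xs) ` coboundaries 3 \<subseteq> coboundaries 3"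
      using comb[of _ 1] by auto
    show "coboundaries 3 \<subseteq> (\<lambda>g xs. g xs + f xs) ` coboundaries 3"
    proof
      fix g assume g: "g \<in> coboundaries 3"
      have "g = (\<lambda>xs. (g xs + (-1) *s f xs) + f xs)" by simp
      then show "g \<in> (\<lambda>g xs. g xs + f xs) ` coboundaries 3"
        using comb[OF g, of "-1"] by (intro image_eqI)
    qed
  qed
  finally show ?thesis .
qed

text \<open>
  The product is a union over all representatives. If every bracket of cocycles is a coboundary, then
  each of the cosets in this union is the group of coboundaries itself.
\<close>

lemma gerstenhaber_product_trivial:
  assumes comm: "\<And>f g. cocycle2 f \<Longrightarrow> cocycle2 g \<Longrightarrow> bracket_exact f g"
    and X: "X \<in> carrier (HH 2)" and Y: "Y \<in> carrier (HH 2)"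
  shows "gerstenhaber_product 2 2 X Y = \<one>\<^bsub>HH 3\<^esub>"
proof -
  have "coboundaries 3 #>\<^bsub>cocycle_group 3\<^esub> gerstenhaber_bracket 2 2 f g = coboundaries 3"
    if "f \<in> X" "g \<in> Y" for f g
    using that HH2_class_cocycles(2)[OF X] HH2_class_cocycles(2)[OF Y]
    by (intro coboundaries_3_coset gerstenhaber_bracket_coboundary comm cocycle2_cocycle_group) auto
  then show ?thesis
    using HH2_class_cocycles(1)[OF X] HH2_class_cocycles(1)[OF Y]
    by (auto simp: gerstenhaber_product_def HH_def FactGroup_def)
qed

end

section \<open>The cone of \<open>\<Lambda>\<^sub>n\<close>\<close>

text \<open>
  The exponents of \<open>u\<close> and \<open>w\<close> in a monomial of \<open>A\<^sub>n\<close>, regarded as an invariant polynomial via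
  \<open>x = w\<^sup>n\<^sup>+\<^sup>1\<close>, \<open>y = u\<^sup>n\<^sup>+\<^sup>1\<close>, \<open>z = u w\<close>. They are also the two facet functionals of the cone.
\<close>

definition alpha :: "int \<times> int \<Rightarrow> int" where "alpha l = fst l"
definition beta :: "nat \<Rightarrow> int \<times> int \<Rightarrow> int" where "beta n l = (int n + 1) * snd l - int n * fst l"

lemma alpha_beta_add [simp]:
  "alpha (l + m) = alpha l + alpha m" "beta n (l + m) = beta n l + beta n m"
  "alpha (l - m) = alpha l - alpha m" "beta n (l - m) = beta n l - beta n m"
  "alpha (i, i) = i" "beta n (i, i) = i"
  by (simp_all add: alpha_def beta_def algebra_simps)

lemma Lambda_iff: "l \<in> Lambda n \<longleftrightarrow> 0 \<le> alpha l \<and> 0 \<le> beta n l"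
proof
  show "l \<in> Lambda n \<Longrightarrow> 0 \<le> alpha l \<and> 0 \<le> beta n l"
  proof (induction rule: Lambda.induct)
    case zero
    show ?case by (simp add: alpha_def beta_def)
  next
    case (gen s v)
    then show ?case by (auto simp: alpha_def beta_def algebra_simps)
  qed
next
  assume *: "0 \<le> alpha l \<and> 0 \<le> beta n l"
  obtain p q where l: "l = (p, q)" by (cases l)
  have "l = toric_exp n (toric_section n l)"
    using * by (auto simp: l toric_exp_def toric_section_def alpha_def beta_def algebra_simps)
  then show "l \<in> Lambda n" by (metis toric_exp_in_Lambda)
qed

text \<open>
  The exponent of \<open>y\<close> when a monomial is written as \<open>x\<^sup>a z\<^sup>c\<close> or \<open>y\<^sup>b z\<^sup>c\<close>.
\<close>

definition y_exp :: "int \<times> int \<Rightarrow> int" where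
  "y_exp l = max 0 (fst l - snd l)"

text \<open>
  The number of factors \<open>x y\<close> that turn into \<open>z\<^sup>n\<^sup>+\<^sup>1\<close> when two such monomials are multiplied. It is the
  coboundary of \<open>y_exp\<close> as an integer function on \<open>\<int>\<^sup>2\<close>. It can still give nontrivial cohomology classes
  of \<open>A\<^sub>n\<close>, because the shift by \<open>z\<^sup>i\<^sup>-\<^sup>n\<^sup>-\<^sup>1\<close> that accompanies it may take a monomial out of the cone.
\<close>

definition carry :: "int \<times> int \<Rightarrow> int \<times> int \<Rightarrow> int" where
  "carry l m = y_exp l + y_exp m - y_exp (l + m)"

definition omega :: "int \<times> int \<Rightarrow> int \<times> int \<Rightarrow> int" where
  "omega l m = fst l * snd m - fst m * snd l"

lemma omega_alpha_beta: "(int n + 1) * omega l m = alpha l * beta n m - alpha m * beta n l"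
  by (simp add: omega_def alpha_def beta_def algebra_simps)

lemma y_exp_shift: "y_exp (l + (i, i)) = y_exp l"
  by (simp add: y_exp_def)

lemma alpha_beta_y_exp: "(int n + 1) * y_exp l = max 0 (alpha l - beta n l)"
proof -
  have "alpha l - beta n l = (int n + 1) * (fst l - snd l)"
    by (simp add: alpha_def beta_def algebra_simps)
  then show ?thesis
    by (simp add: y_exp_def max_def zero_le_mult_iff)
qed

text \<open>
  Every factor \<open>x y = z\<^sup>n\<^sup>+\<^sup>1\<close> of a product contributes \<open>n + 1\<close> to the exponents of both \<open>u\<close> and \<open>w\<close>.
\<close>

lemma carry_bounds:
  assumes "l \<in> Lambda n" "m \<in> Lambda n"
  shows "0 \<le> carry l m" "(int n + 1) * carry l m \<le> alpha (l + m)"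
    "(int n + 1) * carry l m \<le> beta n (l + m)"
proof -
  have "(int n + 1) * carry l m = max 0 (alpha l - beta n l) + max 0 (alpha m - beta n m)
      - max 0 (alpha (l + m) - beta n (l + m))"
    unfolding alpha_beta_y_exp[symmetric] by (simp add: carry_def algebra_simps)
  then show "(int n + 1) * carry l m \<le> alpha (l + m)" "(int n + 1) * carry l m \<le> beta n (l + m)"
    using assms by (auto simp: Lambda_iff)
qed (simp add: carry_def y_exp_def)

lemma carry_support:
  assumes "l \<in> Lambda n" "m \<in> Lambda n" "k \<le> carry l m" "(int n + 1) * k + i \<ge> 0"
  shows "l + m + (i, i) \<in> Lambda n"
proof -
  have "(int n + 1) * k \<le> (int n + 1) * carry l m"
    using assms(3) by (intro mult_left_mono) auto
  then have "0 \<le> alpha (l + m) + i" "0 \<le> beta n (l + m) + i"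
    using carry_bounds[OF assms(1,2)] assms(4) by linarith+
  then show ?thesis
    by (simp add: Lambda_iff)
qed

section \<open>Bilinear operators given on monomials\<close>

abbreviation mon :: "int \<times> int \<Rightarrow> (int \<times> int \<Rightarrow>\<^sub>0 'k::field)" where
  "mon l \<equiv> Poly_Mapping.single l 1"

lemma mon_mult: "mon l * mon m = mon (l + m)"
  by (simp add: mult_single)

lemma mon_cancel: "mon l * (mon (- l) * a) = a" "mon (- l) * (mon l * a) = a"
  by (simp_all add: mult.assoc[symmetric] mon_mult)

definition lin_ext :: "('m \<Rightarrow> ('l \<Rightarrow>\<^sub>0 'k)) \<Rightarrow> ('m \<Rightarrow>\<^sub>0 'k::field) \<Rightarrow> ('l \<Rightarrow>\<^sub>0 'k)" where
  "lin_ext \<Phi> a = (\<Sum>l\<in>Poly_Mapping.keys a. pm_scale (Poly_Mapping.lookup a l) (\<Phi> l))"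

lemma pm_scale_simps:
  "pm_scale 0 p = 0" "pm_scale c 0 = 0" "pm_scale 1 p = p" "pm_scale c (p + q) = pm_scale c p + pm_scale c q"
  "pm_scale (c + d) p = pm_scale c p + pm_scale d p" "pm_scale c (pm_scale d p) = pm_scale (c * d) p"
  "pm_scale c (p - q) = pm_scale c p - pm_scale c q"
  "pm_scale c (Poly_Mapping.single l u) = Poly_Mapping.single l (c * u)"
  by (auto intro!: poly_mapping_eqI simp: lookup_add lookup_minus lookup_single when_def algebra_simps)

lemma pm_scale_sum: "pm_scale c (sum f I) = (\<Sum>i\<in>I. pm_scale c (f i))"
  by (rule poly_mapping_eqI) (simp add: lookup_sum sum_distrib_left)

lemma lin_ext_single [simp]: "lin_ext \<Phi> (Poly_Mapping.single l u) = pm_scale u (\<Phi> l)"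
  by (simp add: lin_ext_def pm_scale_simps)

lemma lin_ext_add: "lin_ext \<Phi> (a + b) = lin_ext \<Phi> a + lin_ext \<Phi> b"
  unfolding lin_ext_def by (rule setsum_keys_plus_distrib) (simp_all add: pm_scale_simps)

lemma lin_ext_scale: "lin_ext \<Phi> (pm_scale c a) = pm_scale c (lin_ext \<Phi> a)"
proof (cases "c = 0")
  case False
  then have "Poly_Mapping.keys (pm_scale c a) = Poly_Mapping.keys a"
    by (auto simp: in_keys_iff)
  then show ?thesis
    by (simp add: lin_ext_def pm_scale_sum pm_scale_simps)
qed (simp add: pm_scale_simps lin_ext_def)

lemma lin_ext_fun_add: "lin_ext (\<lambda>l. \<Phi> l + \<Psi> l) a = lin_ext \<Phi> a + lin_ext \<Psi> a"
  by (simp add: lin_ext_def pm_scale_simps sum.distrib)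

lemma lin_ext_fun_scale: "lin_ext (\<lambda>l. pm_scale c (\<Phi> l)) a = pm_scale c (lin_ext \<Phi> a)"
  by (simp add: lin_ext_def pm_scale_sum pm_scale_simps mult.commute)

lemma lin_ext_closed:
  assumes "a \<in> A_n n" "\<And>l. l \<in> Lambda n \<Longrightarrow> \<Phi> l \<in> A_n n"
  shows "lin_ext \<Phi> a \<in> A_n n"
  unfolding lin_ext_def
  using assms by (intro A_n.subspace_sum[OF A_n.subspace_A] A_n.A_closed) (auto simp: A_n_def)

lemma A_n_induct [consumes 1, case_names zero comb]:
  assumes "a \<in> A_n n" and "P 0"
    and "\<And>a l c. a \<in> A_n n \<Longrightarrow> l \<in> Lambda n \<Longrightarrow> P a \<Longrightarrow>
      P (pm_scale c (mon l) + a)"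
  shows "P a"
proof -
  have *: "finite I \<Longrightarrow> I \<subseteq> Lambda n \<Longrightarrow> (\<Sum>l\<in>I. Poly_Mapping.single l (u l)) \<in> A_n n
      \<and> P (\<Sum>l\<in>I. Poly_Mapping.single l (u l))" for I u
  proof (induction I rule: finite_induct)
    case empty
    show ?case using assms(2) by simp
  next
    case (insert l I)
    then show ?case
      using assms(3)[of "\<Sum>l\<in>I. Poly_Mapping.single l (u l)" l "u l"]
      by (auto simp: pm_scale_simps intro!: A_n.A_closed(2)) (auto simp: A_n_def)
  qed
  have "a = (\<Sum>l\<in>Poly_Mapping.keys a. Poly_Mapping.single l (Poly_Mapping.lookup a l))"
    using push_id[of a] by (simp add: push_def)
  then show ?thesis
    using *[of "Poly_Mapping.keys a" "Poly_Mapping.lookup a"] assms(1) by (auto simp: A_n_def)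
qed

lemma linear_lin_ext:
  assumes "\<And>l. l \<in> Lambda n \<Longrightarrow> \<Phi> l \<in> A_n n"
  shows "A_n.linear_op n (lin_ext \<Phi>)"
  using assms by (auto simp: A_n.linear_op_def lin_ext_add lin_ext_scale intro: lin_ext_closed)

lemma linear_eq_zeroI:
  assumes "A_n.linear_op n \<phi>" "\<And>l. l \<in> Lambda n \<Longrightarrow> \<phi> (mon l) = 0" "a \<in> A_n n"
  shows "\<phi> a = 0"
  using assms(3)
proof (induction rule: A_n_induct)
  case zero
  show ?case by (rule A_n.linear_op_zero[OF assms(1)])
next
  case (comb a l c)
  then show ?case
    using assms(2)[of l] by (subst A_n.linear_op_comb[OF assms(1)]) (auto simp: A_n_def pm_scale_simps)
qed

lemma monomial_in_A_n: "l \<in> Lambda n \<Longrightarrow> Poly_Mapping.single l u \<in> A_n n"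
  by (simp add: A_n_def)

lemma bilinear_eqI:
  assumes f: "A_n.bilinear_op n f" and g: "A_n.bilinear_op n g"
    and eq: "\<And>l m. l \<in> Lambda n \<Longrightarrow> m \<in> Lambda n \<Longrightarrow>
      f (mon l) (mon m)
        = g (mon l) (mon m)"
    and ab: "a \<in> A_n n" "b \<in> A_n n"
  shows "f a b = g a b"
proof -
  have "f (mon l) b - g (mon l) b = 0" if l: "l \<in> Lambda n" for l
    using A_n.linear_op_comp_diff[OF A_n.bilinear_op_slots(2)[OF f] A_n.bilinear_op_slots(2)[OF g],
        OF monomial_in_A_n[OF l] monomial_in_A_n[OF l]] _ ab(2)
    by (rule linear_eq_zeroI) (simp add: eq l)
  with A_n.linear_op_comp_diff[OF A_n.bilinear_op_slots(1)[OF f ab(2)] A_n.bilinear_op_slots(1)[OF g ab(2)]]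
  have "f a b - g a b = 0"
    by (rule linear_eq_zeroI) (use ab in auto)
  then show ?thesis by simp
qed

text \<open>
  The homogeneous bilinear operators of degree \<open>d\<close> with integer coefficients on the group algebra. All
  basic cocycles and all primitives of their brackets have this form.
\<close>

definition bimult :: "(int \<times> int \<Rightarrow> int \<times> int \<Rightarrow> int) \<Rightarrow> int \<times> int \<Rightarrow>
    (int \<times> int \<Rightarrow>\<^sub>0 'k) \<Rightarrow> (int \<times> int \<Rightarrow>\<^sub>0 'k) \<Rightarrow> (int \<times> int \<Rightarrow>\<^sub>0 'k::field)" where
  "bimult F d a b =
     lin_ext (\<lambda>l. lin_ext (\<lambda>m. Poly_Mapping.single (l + m + d) (of_int (F l m))) b) a"

lemma bimult_single [simp]:
  "bimult F d (Poly_Mapping.single l u) (Poly_Mapping.single m w)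
     = Poly_Mapping.single (l + m + d) (u * w * of_int (F l m))"
  by (simp add: bimult_def pm_scale_simps mult.assoc)

lemma bilinear_bimult:
  assumes "\<And>l m. l \<in> Lambda n \<Longrightarrow> m \<in> Lambda n \<Longrightarrow> F l m \<noteq> 0 \<Longrightarrow> l + m + d \<in> Lambda n"
  shows "A_n.bilinear_op n (bimult F d :: _ \<Rightarrow> _ \<Rightarrow> (int \<times> int \<Rightarrow>\<^sub>0 'k::field))"
proof -
  have "(Poly_Mapping.single (l + m + d) (of_int (F l m)) :: _ \<Rightarrow>\<^sub>0 'k) \<in> A_n n"
    if "l \<in> Lambda n" "m \<in> Lambda n" for l m
    using assms[OF that] by (cases "F l m = 0") (auto intro: monomial_in_A_n)
  then show ?thesis
    by (auto simp: A_n.bilinear_op_def A_n.linear_op_def bimult_def lin_ext_add lin_ext_scale lin_ext_fun_add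
        lin_ext_fun_scale intro!: lin_ext_closed)
qed

text \<open>
  On three monomials, the bracket of \<open>bimult F d\<close> with \<open>bimult G e\<close> and the coboundary of
  \<open>bimult H (d + e)\<close> are integer multiples of the same monomial. These are the two integers.
\<close>

definition scalar_bracket ::
    "(int \<times> int \<Rightarrow> int \<times> int \<Rightarrow> int) \<Rightarrow> int \<times> int \<Rightarrow>
     (int \<times> int \<Rightarrow> int \<times> int \<Rightarrow> int) \<Rightarrow> int \<times> int \<Rightarrow>
     int \<times> int \<Rightarrow> int \<times> int \<Rightarrow> int \<times> int \<Rightarrow> int" where
  "scalar_bracket F d G e l m r =
     F (l + m + e) r * G l m - F l (m + r + e) * G m r
     + G (l + m + d) r * F l m - G l (m + r + d) * F m r"

definition scalar_d ::
    "(int \<times> int \<Rightarrow> int \<times> int \<Rightarrow> int) \<Rightarrow>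
     int \<times> int \<Rightarrow> int \<times> int \<Rightarrow> int \<times> int \<Rightarrow> int" where
  "scalar_d H l m r = H m r - H (l + m) r + H l (m + r) - H l m"

text \<open>
  The denominator \<open>c\<close> keeps all coefficient functions integral. It is invertible in characteristic 0.
\<close>

lemma bracket_exact_bimult:
  fixes F G H :: "int \<times> int \<Rightarrow> int \<times> int \<Rightarrow> int"
  assumes f: "A_n.bilinear_op n (bimult F d :: _ \<Rightarrow> _ \<Rightarrow> (int \<times> int \<Rightarrow>\<^sub>0 'k::field_char_0))"
    and g: "A_n.bilinear_op n (bimult G e :: _ \<Rightarrow> _ \<Rightarrow> (int \<times> int \<Rightarrow>\<^sub>0 'k))"
    and h: "A_n.bilinear_op n (bimult H (d + e) :: _ \<Rightarrow> _ \<Rightarrow> (int \<times> int \<Rightarrow>\<^sub>0 'k))"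
    and c: "c \<noteq> 0" and eq: "\<And>l m r. c * scalar_bracket F d G e l m r = scalar_d H l m r"
  shows "A_n.bracket_exact n (bimult F d :: _ \<Rightarrow> _ \<Rightarrow> (int \<times> int \<Rightarrow>\<^sub>0 'k)) (bimult G e)"
proof -
  define h' :: "(int \<times> int \<Rightarrow>\<^sub>0 'k) \<Rightarrow> (int \<times> int \<Rightarrow>\<^sub>0 'k) \<Rightarrow> (int \<times> int \<Rightarrow>\<^sub>0 'k)"
    where "h' = (\<lambda>a b. pm_scale (1 / of_int c) (bimult H (d + e) a b))"
  let ?e = "\<lambda>l. Poly_Mapping.single l (1::'k)"
  have h': "A_n.bilinear_op n h'" unfolding h'_def by (rule A_n.bilinear_op_mult_scalar[OF h])
  let ?t = "\<lambda>x y z. A_n.bracket (bimult F d) (bimult G e) x y z - A_n.delta2 h' x y z"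
  note lin = A_n.linear_op_bracket_diff_delta2[OF f g h']
  have 0: "?t (?e l) (?e m) (?e r) = 0" for l m r
  proof -
    have s: "of_int (scalar_bracket F d G e l m r) = (of_int (scalar_d H l m r) / of_int c :: 'k)"
      using arg_cong[OF eq[of l m r], of "of_int :: int \<Rightarrow> 'k"] c by (simp add: field_simps)
    have "A_n.bracket (bimult F d) (bimult G e) (?e l) (?e m) (?e r)
        = Poly_Mapping.single (l + m + r + d + e) (of_int (scalar_bracket F d G e l m r))"
      by (simp add: A_n.bracket_def scalar_bracket_def single_add single_diff ac_simps)
    moreover have "A_n.delta2 h' (?e l) (?e m) (?e r)
        = Poly_Mapping.single (l + m + r + d + e) (of_int (scalar_d H l m r) / of_int c)"
      by (simp add: A_n.delta2_def h'_def scalar_d_def pm_scale_simps mult_single single_add[symmetric]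
          single_diff[symmetric] ac_simps diff_divide_distrib add_divide_distrib)
    ultimately show ?thesis by (simp add: s)
  qed
  have 1: "?t (?e l) (?e m) z = 0" if "l \<in> Lambda n" "m \<in> Lambda n" "z \<in> A_n n" for l m z
    using lin(3)[OF monomial_in_A_n monomial_in_A_n] 0 that(3)
    by (rule linear_eq_zeroI) (use that in auto)
  have 2: "?t (?e l) y z = 0" if "l \<in> Lambda n" "y \<in> A_n n" "z \<in> A_n n" for l y z
    using lin(2)[OF monomial_in_A_n] 1 that(2)
    by (rule linear_eq_zeroI) (use that in auto)
  have 3: "?t x y z = 0" if "x \<in> A_n n" "y \<in> A_n n" "z \<in> A_n n" for x y z
    using lin(1) 2 that(1)
    by (rule linear_eq_zeroI) (use that in auto)
  show ?thesis
    unfolding A_n.bracket_exact_def using h' 3 by auto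
qed

section \<open>Brackets of the basic cocycles as coboundaries on \<open>\<int>\<^sup>2\<close>\<close>

text \<open>
  The coefficient of \<open>t\<^sup>2\<close> in \<open>(z\<^sup>n\<^sup>+\<^sup>1 + t g)\<^sup>N\<close> has the binomial coefficient \<open>N (N - 1) / 2\<close>, and
  associativity of the deformed product in order \<open>t\<^sup>2\<close> is the case of equal arguments. The factor \<open>1 / 2\<close>
  disappears by polarization. In the computation, both ways of bracketing a triple product have the
  same total number of carries, so that the two sums of squares differ by twice the difference of the
  mixed products.
\<close>

lemma bracket_carry_carry:
  "scalar_bracket carry (i, i) carry (j, j) l m r
     = scalar_d (\<lambda>l m. carry l m * (carry l m - 1)) l m r"
proof -
  have shift: "carry (l + (i, i)) m = carry l m" "carry m (l + (i, i)) = carry m l" for l m i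
    using y_exp_shift[of l i] y_exp_shift[of "l + m" i]
    by (simp_all add: carry_def ac_simps)
  have "scalar_bracket carry (i, i) carry (j, j) l m r
      = 2 * (carry (l + m) r * carry l m - carry l (m + r) * carry m r)"
    unfolding scalar_bracket_def shift by simp
  then show ?thesis
    by (simp add: scalar_d_def carry_def algebra_simps)
qed

text \<open>
  On the group algebra, \<open>carry\<close> is the coboundary of the operator that multiplies a monomial \<open>l\<close> by
  \<open>y_exp l\<close> and shifts it by \<open>(i, i)\<close>. A primitive of the bracket with \<open>omega\<close> is therefore minus the
  bracket of this operator with \<open>omega\<close>. This primitive does not preserve \<open>A\<^sub>n\<close>. The additional term
  with \<open>y_exp h\<close> is a multiple of the biderivation \<open>omega\<close>, thus a cocycle, and repairs this. The result
  is, up to sign, the first order term of the bracket \<open>h \<partial>\<^sub>u \<and> \<partial>\<^sub>w\<close> on the surface \<open>x y = z\<^sup>n\<^sup>+\<^sup>1 + t g(z)\<close>.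
\<close>

definition carry_omega :: "int \<times> int \<Rightarrow> int \<Rightarrow> int \<times> int \<Rightarrow> int \<times> int \<Rightarrow> int" where
  "carry_omega h i l m = i * (y_exp l * (snd m - fst m) - y_exp m * (snd l - fst l))
      - omega l m * (y_exp (l + m + h) - y_exp l - y_exp m - y_exp h)"

lemma bracket_carry_omega:
  "scalar_bracket carry (i, i) omega (h - (1, 1)) l m r = scalar_d (carry_omega h i) l m r"
proof -
  have s: "y_exp (l + (h - (1, 1))) = y_exp (l + h)" for l
    using y_exp_shift[of "l + h" "-1"] by (simp add: y_exp_def)
  have s2: "y_exp (l + m + (h - (1, 1)) + r) = y_exp (l + m + r + h)"
      "y_exp (l + (m + r + (h - (1, 1)))) = y_exp (l + m + r + h)"
    using s[of "l + m + r"] by (simp_all add: ac_simps)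
  obtain l1 l2 m1 m2 r1 r2 h1 h2 where [simp]: "l = (l1, l2)" "m = (m1, m2)" "r = (r1, r2)" "h = (h1, h2)"
    by (metis surj_pair)
  have gen: "scalar_bracket carry (i, i) omega (h - (1, 1)) l m r =
    (y_exp (l + m + h) + y_exp r - y_exp (l + m + r + h)) * omega l m
    - (y_exp l + y_exp (m + r + h) - y_exp (l + m + r + h)) * omega m r
    + omega (l + m + (i, i)) r * carry l m - omega l (m + r + (i, i)) * carry m r"
    unfolding scalar_bracket_def carry_def s s2 by (simp only: s)
  show ?thesis
    unfolding gen scalar_d_def carry_omega_def carry_def
    by (simp add: omega_def algebra_simps)
qed

text \<open>
  For the Poisson bracket \<open>h \<partial>\<^sub>u \<and> \<partial>\<^sub>w\<close>, the second order term of Kontsevich's star product is the sum of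
  \<open>h\<^sup>2 / 2 (\<partial>\<^sub>u\<^sup>2 \<otimes> \<partial>\<^sub>w\<^sup>2 - 2 \<partial>\<^sub>u \<partial>\<^sub>w \<otimes> \<partial>\<^sub>u \<partial>\<^sub>w + \<partial>\<^sub>w\<^sup>2 \<otimes> \<partial>\<^sub>u\<^sup>2)\<close>,
  \<open>h h\<^sub>w / 3 (\<partial>\<^sub>u\<^sup>2 \<otimes> \<partial>\<^sub>w - \<partial>\<^sub>u \<partial>\<^sub>w \<otimes> \<partial>\<^sub>u - \<partial>\<^sub>u \<otimes> \<partial>\<^sub>u \<partial>\<^sub>w + \<partial>\<^sub>w \<otimes> \<partial>\<^sub>u\<^sup>2)\<close> and
  \<open>- h h\<^sub>u / 3 (\<partial>\<^sub>u \<partial>\<^sub>w \<otimes> \<partial>\<^sub>w - \<partial>\<^sub>w\<^sup>2 \<otimes> \<partial>\<^sub>u - \<partial>\<^sub>u \<otimes> \<partial>\<^sub>w\<^sup>2 + \<partial>\<^sub>w \<otimes> \<partial>\<^sub>u \<partial>\<^sub>w)\<close>.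
  The definition gives 3 times the mixed part for a sum of two monomials in place of \<open>h\<close>, evaluated on
  monomials. The mixed part depends only on the product of the two monomials, whose exponent is the
  argument \<open>h\<close>. In the coordinates \<open>u\<close>, \<open>w\<close> the formula has polynomial coefficients and preserves the
  invariants, so that it defines an operator on \<open>A\<^sub>n\<close>.
\<close>

definition moyal2 :: "nat \<Rightarrow> int \<times> int \<Rightarrow> int \<times> int \<Rightarrow> int \<times> int \<Rightarrow> int" where
  "moyal2 n h l m = (let a = alpha l; b = beta n l; c = alpha m; d = beta n m in
     3 * (a * (a - 1) * d * (d - 1) - 2 * a * b * c * d + b * (b - 1) * c * (c - 1))
     + beta n h * (a * (a - 1) * d - a * b * c - a * c * d + b * c * (c - 1))
     - alpha h * (a * b * d - b * (b - 1) * c - a * d * (d - 1) + b * c * d))"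

text \<open>
  The factor \<open>(n + 1)\<^sup>2\<close> occurs because \<open>omega\<close> is the determinant in the coordinates of \<open>\<int>\<^sup>2\<close>, while the
  star product uses the exponents of \<open>u\<close> and \<open>w\<close>.
\<close>

lemma bracket_omega_omega:
  "3 * (int n + 1)\<^sup>2 * scalar_bracket omega (h - (1, 1)) omega (h' - (1, 1)) l m r
     = scalar_d (moyal2 n (h + h')) l m r"
proof -
  let ?w = "\<lambda>l m. (int n + 1) * omega l m"
  have "3 * (int n + 1)\<^sup>2 * scalar_bracket omega (h - (1, 1)) omega (h' - (1, 1)) l m r
      = 3 * scalar_bracket ?w (h - (1, 1)) ?w (h' - (1, 1)) l m r"
    by (simp add: scalar_bracket_def power2_eq_square algebra_simps)
  also have "\<dots> = scalar_d (moyal2 n (h + h')) l m r"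
    unfolding omega_alpha_beta scalar_bracket_def scalar_d_def moyal2_def Let_def alpha_beta_add
    by algebra
  finally show ?thesis .
qed

section \<open>Integrality of the basic cocycles and of the primitives\<close>

text \<open>
  If the product of two monomials lies on a facet of the cone, both factors lie on that facet and
  their determinant is zero. Otherwise the product is divisible by \<open>z\<close>.
\<close>

lemma omega_support:
  assumes "l \<in> Lambda n" "m \<in> Lambda n" "h \<in> Lambda n" "omega l m \<noteq> 0"
  shows "l + m + (h - (1, 1)) \<in> Lambda n"
proof -
  have "alpha l * beta n m - alpha m * beta n l \<noteq> 0"
    using assms(4) unfolding omega_alpha_beta[symmetric] by auto
  then have "\<not> (alpha l = 0 \<and> alpha m = 0)" "\<not> (beta n l = 0 \<and> beta n m = 0)"
    by auto
  then show ?thesis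
    using assms(1-3) by (auto simp: Lambda_iff)
qed

text \<open>
  Each term of the star product differentiates twice with respect to \<open>u\<close> and twice with respect to \<open>w\<close>,
  where the derivatives are distributed over the two arguments and the product of the two coefficients.
  If the resulting exponent of \<open>u\<close> is negative, the total exponent of \<open>u\<close> before differentiation was at
  most 1, and two derivatives annihilate every term. The same holds for \<open>w\<close>.
\<close>

lemma moyal2_support:
  assumes "l \<in> Lambda n" "m \<in> Lambda n" "h \<in> Lambda n" "h' \<in> Lambda n"
    "moyal2 n (h + h') l m \<noteq> 0"
  shows "l + m + ((h - (1, 1)) + (h' - (1, 1))) \<in> Lambda n"
proof (rule ccontr)
  assume *: "l + m + ((h - (1, 1)) + (h' - (1, 1))) \<notin> Lambda n"
  let ?h = "h + h'"
  have nonneg: "alpha l \<ge> 0" "alpha m \<ge> 0" "alpha ?h \<ge> 0" "beta n l \<ge> 0" "beta n m \<ge> 0" "beta n ?h \<ge> 0"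
    using assms(1-4) by (auto simp: Lambda_iff)
  have small: "(p = 0 \<and> q = 0) \<or> (p = 1 \<and> q = 0 \<and> r = 0) \<or> (p = 0 \<and> q = 1 \<and> r = 0)"
    if "p + q + r \<le> 1" "p \<ge> 0" "q \<ge> 0" "r \<ge> 0" for p q r :: int
    using that by arith
  have "alpha l + alpha m + alpha ?h \<le> 1 \<or> beta n l + beta n m + beta n ?h \<le> 1"
    using * by (auto simp: Lambda_iff simp del: diff_Pair add_Pair)
  then have "moyal2 n ?h l m = 0"
  proof
    assume "alpha l + alpha m + alpha ?h \<le> 1"
    from small[OF this nonneg(1-3)] show ?thesis
      unfolding moyal2_def Let_def by (elim disjE conjE) (simp_all del: alpha_beta_add)
  next
    assume "beta n l + beta n m + beta n ?h \<le> 1"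
    from small[OF this nonneg(4-6)] show ?thesis
      unfolding moyal2_def Let_def by (elim disjE conjE) (simp_all del: alpha_beta_add)
  qed
  then show False using assms(5) by simp
qed

text \<open>
  The facet \<open>alpha = 0\<close>. Here \<open>p\<close> is the exponent of \<open>u\<close> and \<open>v\<close> is the exponent of \<open>x\<close> minus that of
  \<open>y\<close>, so that \<open>p + N v\<close> is the exponent of \<open>w\<close> and \<open>max 0 (- v)\<close> is the exponent of \<open>y\<close>. A monomial with
  \<open>v < 0\<close> contains \<open>y = u\<^sup>N\<close>. As the exponents of \<open>u\<close> add up to at most \<open>N\<close>, at most one of the three
  monomials contains \<open>y\<close>. If it is one of the first two, it is equal to \<open>y\<close> and the other two are powers
  of \<open>x\<close>. If it is the third, the first two are powers of \<open>x\<close>. In both cases, and also if \<open>y\<close> does not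
  occur, the two sides agree by inspection.
\<close>

lemma carry_omega_support_aux:
  fixes N p1 p2 p3 v1 v2 v3 i :: int
  assumes "N \<ge> 1" "i \<ge> 0" "p1 \<ge> 0" "p2 \<ge> 0" "p3 \<ge> 0"
    "p1 + N * v1 \<ge> 0" "p2 + N * v2 \<ge> 0" "p3 + N * v3 \<ge> 0"
    and small: "p1 + p2 + p3 + (i - N) < 1"
  defines "s \<equiv> \<lambda>v. max 0 (- v)"
  shows "(i - N) * (s v1 * v2 - s v2 * v1)
      = (p1 * v2 - p2 * v1) * (s (v1 + v2 + v3) - s v1 - s v2 - s v3)"
proof -
  have neg: "p \<ge> N" "p = N \<Longrightarrow> v = -1" if "v < 0" "p + N * v \<ge> 0" for p v
  proof -
    have "N * v \<le> N * (-1)" using that assms(1) by (intro mult_left_mono) auto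
    then show "p \<ge> N" using that by simp
    assume "p = N"
    then have "0 \<le> N * (1 + v)" using that by (simp add: algebra_simps)
    then show "v = -1" using that assms(1) by (simp add: zero_le_mult_iff)
  qed
  have others: "v \<ge> 0" if "p = 0" "p + N * v \<ge> 0" for p v
    using that assms(1) by (simp add: zero_le_mult_iff)
  consider "v1 < 0" | "v2 < 0" | "v3 < 0" | "v1 \<ge> 0" "v2 \<ge> 0" "v3 \<ge> 0" by linarith
  then show ?thesis
  proof cases
    case 1
    then have "p1 = N" "i = 0" "p2 = 0" "p3 = 0" using neg(1)[of v1 p1] assms by linarith+
    moreover from this have "v1 = -1" "v2 \<ge> 0" "v3 \<ge> 0"
      using neg(2)[OF 1 assms(6)] others[OF _ assms(7)] others[OF _ assms(8)] by blast+
    ultimately show ?thesis by (cases "v2 = 0") (auto simp: s_def)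
  next
    case 2
    then have "p2 = N" "i = 0" "p1 = 0" "p3 = 0" using neg(1)[of v2 p2] assms by linarith+
    moreover from this have "v2 = -1" "v1 \<ge> 0" "v3 \<ge> 0"
      using neg(2)[OF 2 assms(7)] others[OF _ assms(6)] others[OF _ assms(8)] by blast+
    ultimately show ?thesis by (cases "v1 = 0") (auto simp: s_def)
  next
    case 3
    then have "p1 = 0" "p2 = 0" using neg(1)[of v3 p3] assms by linarith+
    moreover from this have "v1 \<ge> 0" "v2 \<ge> 0"
      using others[OF _ assms(6)] others[OF _ assms(7)] by blast+
    ultimately show ?thesis by (auto simp: s_def)
  qed (auto simp: s_def)
qed

text \<open>
  For the facet \<open>beta = 0\<close> the roles of \<open>x\<close> and \<open>y\<close> are exchanged. This replaces the exponent of \<open>y\<close> by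
  that of \<open>x\<close>, which differs from it by the additive function \<open>v\<close>, and this difference cancels.
\<close>

lemma carry_omega_support:
  assumes "l \<in> Lambda n" "m \<in> Lambda n" "h \<in> Lambda n" "i \<ge> 0"
    and nz: "carry_omega h (i - (int n + 1)) l m \<noteq> 0"
  shows "l + m + ((i - (int n + 1), i - (int n + 1)) + (h - (1, 1))) \<in> Lambda n"
proof (rule ccontr)
  let ?N = "int n + 1" and ?s = "\<lambda>v::int. max 0 (- v)"
  assume *: "l + m + ((i - ?N, i - ?N) + (h - (1, 1))) \<notin> Lambda n"
  obtain p1 q1 p2 q2 p3 q3 where [simp]: "l = (p1, q1)" "m = (p2, q2)" "h = (p3, q3)"
    by (metis surj_pair)
  define v1 v2 v3 where v: "v1 = q1 - p1" "v2 = q2 - p2" "v3 = q3 - p3"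
  have q: "q1 = p1 + v1" "q2 = p2 + v2" "q3 = p3 + v3" by (simp_all add: v)
  have nn: "p1 \<ge> 0" "p2 \<ge> 0" "p3 \<ge> 0" "p1 + ?N * v1 \<ge> 0" "p2 + ?N * v2 \<ge> 0" "p3 + ?N * v3 \<ge> 0"
    using assms(1-3) by (simp_all add: Lambda_iff alpha_def beta_def q algebra_simps)
  have "p1 + p2 + p3 + (i - ?N) < 1 \<or>
      (p1 + ?N * v1) + (p2 + ?N * v2) + (p3 + ?N * v3) + (i - ?N) < 1"
    using * by (auto simp: Lambda_iff alpha_def beta_def q algebra_simps)
  then have "(i - ?N) * (?s v1 * v2 - ?s v2 * v1)
      = (p1 * v2 - p2 * v1) * (?s (v1 + v2 + v3) - ?s v1 - ?s v2 - ?s v3)"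
  proof
    assume "p1 + p2 + p3 + (i - ?N) < 1"
    then show ?thesis using carry_omega_support_aux[of ?N i p1 p2 p3 v1 v2 v3] nn assms(4) by simp
  next
    assume "(p1 + ?N * v1) + (p2 + ?N * v2) + (p3 + ?N * v3) + (i - ?N) < 1"
    then have eq: "(i - ?N) * (?s (- v1) * (- v2) - ?s (- v2) * (- v1))
      = ((p1 + ?N * v1) * (- v2) - (p2 + ?N * v2) * (- v1))
        * (?s (- v1 - v2 - v3) - ?s (- v1) - ?s (- v2) - ?s (- v3))"
      using carry_omega_support_aux[of ?N i "p1 + ?N * v1" "p2 + ?N * v2" "p3 + ?N * v3" "- v1" "- v2" "- v3"]
        nn assms(4) by simp
    have s: "?s (- v) = ?s v + v" for v by (simp add: max_def)
    have s': "?s (- v1 - v2 - v3) = ?s (v1 + v2 + v3) + (v1 + v2 + v3)"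
      using s[of "v1 + v2 + v3"] by (simp add: algebra_simps)
    show ?thesis using eq unfolding s s' by (simp add: algebra_simps)
  qed
  then have "carry_omega h (i - ?N) l m = 0"
    by (simp add: carry_omega_def y_exp_def omega_def q algebra_simps)
  then show False using nz by simp
qed

text \<open>
  The first order terms of \<open>x y = z\<^sup>n\<^sup>+\<^sup>1 + t z\<^sup>i\<close> and of the Poisson bracket with coefficient the monomial
  \<open>h\<close>, up to a constant factor. The shift by \<open>(- 1, - 1)\<close> is the division by \<open>u w\<close> in \<open>\<partial>\<^sub>u \<and> \<partial>\<^sub>w\<close>.
\<close>

definition basic_cocycles ::
    "nat \<Rightarrow> ((int \<times> int \<Rightarrow>\<^sub>0 'k) \<Rightarrow> (int \<times> int \<Rightarrow>\<^sub>0 'k) \<Rightarrow> (int \<times> int \<Rightarrow>\<^sub>0 'k::field_char_0)) set" where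
  "basic_cocycles n = {bimult carry (i - (int n + 1), i - (int n + 1)) |i. i \<ge> 0}
     \<union> {bimult omega (h - (1, 1)) |h. h \<in> Lambda n}"

lemma bilinear_carry:
  assumes "i \<ge> 0"
  shows "A_n.bilinear_op n (bimult carry (i - (int n + 1), i - (int n + 1)))"
proof (rule bilinear_bimult)
  fix l m assume "l \<in> Lambda n" "m \<in> Lambda n" "carry l m \<noteq> 0"
  then show "l + m + (i - (int n + 1), i - (int n + 1)) \<in> Lambda n"
    using carry_bounds(1)[of l n m] assms by (intro carry_support[where k = 1]) auto
qed

lemma bilinear_omega: "h \<in> Lambda n \<Longrightarrow> A_n.bilinear_op n (bimult omega (h - (1, 1)))"
  by (intro bilinear_bimult omega_support)

lemma bilinear_basic: "f \<in> basic_cocycles n \<Longrightarrow> A_n.bilinear_op n f"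
  unfolding basic_cocycles_def using bilinear_carry bilinear_omega by blast

lemma bracket_exact_carry_carry:
  assumes "i \<ge> 0" "j \<ge> 0"
  shows "A_n.bracket_exact n (bimult carry (i - (int n + 1), i - (int n + 1)))
    (bimult carry (j - (int n + 1), j - (int n + 1)) ::
      _ \<Rightarrow> _ \<Rightarrow> (int \<times> int \<Rightarrow>\<^sub>0 'k::field_char_0))"
proof (rule bracket_exact_bimult[OF bilinear_carry[OF assms(1)] bilinear_carry[OF assms(2)], where c = 1])
  let ?N = "int n + 1"
  have eq: "(i - ?N, i - ?N) + (j - ?N, j - ?N) = (i + j - 2 * ?N, i + j - 2 * ?N)"
    by simp
  show "A_n.bilinear_op n (bimult (\<lambda>l m. carry l m * (carry l m - 1)) ((i - ?N, i - ?N) + (j - ?N, j - ?N)))"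
    unfolding eq
  proof (rule bilinear_bimult)
    fix l m assume lm: "l \<in> Lambda n" "m \<in> Lambda n" "carry l m * (carry l m - 1) \<noteq> 0"
    have "carry l m \<noteq> 0" "carry l m \<noteq> 1" using lm(3) by auto
    then have "2 \<le> carry l m" using carry_bounds(1)[OF lm(1,2)] by linarith
    then show "l + m + (i + j - 2 * ?N, i + j - 2 * ?N) \<in> Lambda n"
      using assms lm by (intro carry_support[where k = 2]) auto
  qed
qed (simp_all only: bracket_carry_carry mult_1 one_neq_zero not_False_eq_True)

lemma bracket_exact_carry_omega:
  assumes "i \<ge> 0" "h \<in> Lambda n"
  shows "A_n.bracket_exact n (bimult carry (i - (int n + 1), i - (int n + 1)))
    (bimult omega (h - (1, 1)) :: _ \<Rightarrow> _ \<Rightarrow> (int \<times> int \<Rightarrow>\<^sub>0 'k::field_char_0))"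
proof (rule bracket_exact_bimult[OF bilinear_carry[OF assms(1)] bilinear_omega[OF assms(2)], where c = 1])
  show "A_n.bilinear_op n (bimult (carry_omega h (i - (int n + 1)))
      ((i - (int n + 1), i - (int n + 1)) + (h - (1, 1))))"
    using assms by (intro bilinear_bimult carry_omega_support)
  show "1 * scalar_bracket carry (i - (int n + 1), i - (int n + 1)) omega (h - (1, 1)) l m r
      = scalar_d (carry_omega h (i - (int n + 1))) l m r" for l m r
    unfolding bracket_carry_omega by (rule mult_1)
qed simp

lemma bracket_exact_omega_omega:
  assumes "h \<in> Lambda n" "h' \<in> Lambda n"
  shows "A_n.bracket_exact n (bimult omega (h - (1, 1)))
    (bimult omega (h' - (1, 1)) :: _ \<Rightarrow> _ \<Rightarrow> (int \<times> int \<Rightarrow>\<^sub>0 'k::field_char_0))"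
proof (rule bracket_exact_bimult[OF bilinear_omega[OF assms(1)] bilinear_omega[OF assms(2)]
      _ _ bracket_omega_omega[where n = n]])
  show "A_n.bilinear_op n (bimult (moyal2 n (h + h')) ((h - (1, 1)) + (h' - (1, 1))))"
    using assms by (intro bilinear_bimult moyal2_support)
  have "int n + 1 \<noteq> 0" by linarith
  then show "3 * (int n + 1)\<^sup>2 \<noteq> 0" by simp
qed

lemma bracket_exact_basic:
  assumes fg: "f \<in> basic_cocycles n" "g \<in> basic_cocycles n"
  shows "A_n.bracket_exact n f g"
  using fg unfolding basic_cocycles_def
  by (elim UnE CollectE exE conjE; hypsubst)
    (intro bracket_exact_carry_carry bracket_exact_carry_omega bracket_exact_omega_omega
      A_n.bracket_exact_sym[OF bracket_exact_carry_omega]; assumption)+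

section \<open>Combinations of basic cocycles\<close>

text \<open>
  The linear span of the basic cocycles. The inductive form makes the proof that brackets are exact
  an induction over linear combinations in each of the two arguments.
\<close>

inductive basic_span :: "nat \<Rightarrow>
    ((int \<times> int \<Rightarrow>\<^sub>0 'k) \<Rightarrow> (int \<times> int \<Rightarrow>\<^sub>0 'k) \<Rightarrow> (int \<times> int \<Rightarrow>\<^sub>0 'k::field_char_0)) \<Rightarrow> bool"
  for n where
  zero: "basic_span n (\<lambda>a b. 0)"
| comb: "basic_span n f \<Longrightarrow> g \<in> basic_cocycles n \<Longrightarrow>
    basic_span n (\<lambda>a b. f a b + pm_scale c (g a b))"

lemma bilinear_basic_span: "basic_span n f \<Longrightarrow> A_n.bilinear_op n f"
proof (induction rule: basic_span.induct)
  case zero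
  show ?case by (rule A_n.bilinear_op_zero)
next
  case (comb f g c)
  then show ?case
    by (intro A_n.bilinear_op_sum A_n.bilinear_op_mult_scalar) (simp_all add: bilinear_basic)
qed

lemma bracket_exact_basic_span:
  assumes "basic_span n f" "basic_span n g"
  shows "A_n.bracket_exact n f g"
proof -
  have *: "A_n.bracket_exact n f g" if "basic_span n f" "A_n.bilinear_op n g"
    "\<And>f. f \<in> basic_cocycles n \<Longrightarrow> A_n.bracket_exact n f g" for f g :: "_ \<Rightarrow> _ \<Rightarrow> (int \<times> int \<Rightarrow>\<^sub>0 'a)"
    using that(1)
  proof (induction rule: basic_span.induct)
    case zero
    show ?case by (rule A_n.bracket_exact_zero[OF that(2)])
  next
    case (comb f f' c)
    then show ?case
      by (intro A_n.bracket_exact_lincomb that(2))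
        (simp_all add: bilinear_basic bilinear_basic_span that(3))
  qed
  have "A_n.bracket_exact n f' g" if "f' \<in> basic_cocycles n" for f'
    by (rule A_n.bracket_exact_sym, rule *[OF assms(2) bilinear_basic[OF that]])
      (rule bracket_exact_basic[OF _ that])
  then show ?thesis
    by (rule *[OF assms(1) bilinear_basic_span[OF assms(2)]])
qed

lemma basic_span_add:
  assumes "basic_span n f" "basic_span n g"
  shows "basic_span n (\<lambda>a b. f a b + g a b)"
  using assms(2)
proof (induction rule: basic_span.induct)
  case zero
  then show ?case using assms(1) by simp
next
  case (comb g g' c)
  from basic_span.comb[OF comb.IH comb.hyps(2), of c] show ?case
    by (simp add: add.assoc)
qed

lemma basic_span_scale:
  assumes "basic_span n f"
  shows "basic_span n (\<lambda>a b. pm_scale c (f a b))"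
  using assms
proof (induction rule: basic_span.induct)
  case zero
  then show ?case using basic_span.zero by (simp add: pm_scale_simps)
next
  case (comb g g' d)
  from basic_span.comb[OF comb.IH comb.hyps(2), of "c * d"] show ?case
    by (simp add: pm_scale_simps)
qed

lemma basic_span_basic: "f \<in> basic_cocycles n \<Longrightarrow> basic_span n f"
  using basic_span.comb[OF basic_span.zero, of f n 1] by (simp add: pm_scale_simps)

lemma pm_scale_mult_left: "pm_scale c a * b = pm_scale c (a * (b :: (int \<times> int) \<Rightarrow>\<^sub>0 'k::field))"
  by (simp add: pm_scale_conv_mult mult.assoc)

lemma mult_lin_ext:
  fixes p :: "(int \<times> int) \<Rightarrow>\<^sub>0 'k::field"
  shows "p * lin_ext \<Phi> a = lin_ext (\<lambda>l. p * \<Phi> l) a"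
  by (simp add: lin_ext_def sum_distrib_left pm_scale_mult_right)

lemma mon_mult_bimult: "mon l * bimult F d a b = bimult F (l + d) a b"
  by (simp add: bimult_def mult_lin_ext mult_single ac_simps)

text \<open>
  This is the cocycle of the Poisson bracket with an arbitrary coefficient \<open>h\<close> in place of a monomial.
\<close>

lemma basic_span_omega:
  assumes "h \<in> A_n n"
  shows "basic_span n (\<lambda>a b. h * bimult omega (- (1, 1)) a b)"
  using assms
proof (induction rule: A_n_induct)
  case zero
  show ?case by (simp add: basic_span.zero)
next
  case (comb h l c)
  have "bimult omega (l - (1, 1)) \<in> basic_cocycles n"
    using comb(2) unfolding basic_cocycles_def by blast
  then have "basic_span n (\<lambda>a b. pm_scale c (mon l * bimult omega (- (1, 1)) a b))"
    unfolding mon_mult_bimult add_uminus_conv_diff by (intro basic_span_scale basic_span_basic)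
  from basic_span_add[OF this comb(3)] show ?case
    by (simp add: distrib_right pm_scale_mult_left)
qed

text \<open>
  The admissible defects of the relation \<open>x y = z\<^sup>n\<^sup>+\<^sup>1\<close>. Polynomials in \<open>z\<close> are admissible.
\<close>

definition carry_coeff :: "nat \<Rightarrow> (int \<times> int \<Rightarrow>\<^sub>0 'k::field_char_0) \<Rightarrow> bool" where
  "carry_coeff n r \<longleftrightarrow> basic_span n (\<lambda>a b. r * bimult carry (- (int n + 1), - (int n + 1)) a b)"

text \<open>
  A monomial that is not a power of \<open>z\<close> is divisible by \<open>x\<close> or by \<open>y\<close>.
\<close>

lemma A_n_decomp:
  assumes "a \<in> A_n n"
  shows "\<exists>r p q. carry_coeff n r \<and> p \<in> A_n n \<and> q \<in> A_n n \<and>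
    a = r + mon (0, 1) * p + mon (int n + 1, int n) * q"
  using assms
proof (induction rule: A_n_induct)
  case zero
  have "carry_coeff n (0 :: int \<times> int \<Rightarrow>\<^sub>0 'a)" by (simp add: carry_coeff_def basic_span.zero)
  then show ?case by (intro exI[of _ 0]) auto
next
  case (comb a l c)
  then obtain r p q where *: "carry_coeff n r" "p \<in> A_n n" "q \<in> A_n n"
      "a = r + mon (0, 1) * p + mon (int n + 1, int n) * q"
    by blast
  consider "fst l < snd l" | "fst l > snd l" | "fst l = snd l" by linarith
  then show ?case
  proof cases
    case 1
    have "(int n + 1) * fst l \<le> (int n + 1) * (snd l - 1)"
      using 1 by (intro mult_left_mono) auto
    then have "l - (0, 1) \<in> Lambda n"
      using comb(2) by (auto simp: Lambda_iff alpha_def beta_def algebra_simps)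
    then have "pm_scale c (mon (l - (0, 1))) + p \<in> A_n n"
      using * by (intro A_n.A_closed monomial_in_A_n)
    moreover have "mon (0, 1) * pm_scale c (mon (l - (0, 1))) = pm_scale c (mon l)"
      by (simp add: pm_scale_mult_right mon_mult)
    ultimately show ?thesis
      using * by (intro exI[of _ r] exI[of _ "pm_scale c (mon (l - (0, 1))) + p"] exI[of _ q])
        (simp add: distrib_left)
  next
    case 2
    have "(int n + 1) * snd l \<le> (int n + 1) * (fst l - 1)"
      using 2 by (intro mult_left_mono) auto
    then have "l - (int n + 1, int n) \<in> Lambda n"
      using comb(2) by (auto simp: Lambda_iff alpha_def beta_def algebra_simps)
    then have "pm_scale c (mon (l - (int n + 1, int n))) + q \<in> A_n n"
      using * by (intro A_n.A_closed monomial_in_A_n)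
    moreover have "mon (int n + 1, int n) * pm_scale c (mon (l - (int n + 1, int n))) = pm_scale c (mon l)"
      by (simp add: pm_scale_mult_right mon_mult)
    ultimately show ?thesis
      using * by (intro exI[of _ r] exI[of _ p] exI[of _ "pm_scale c (mon (l - (int n + 1, int n))) + q"])
        (simp add: distrib_left)
  next
    case 3
    then obtain i where l: "l = (i, i)" by (cases l) auto
    then have "i \<ge> 0" using comb(2) by (simp add: Lambda_iff alpha_def)
    then have "bimult carry (i - (int n + 1), i - (int n + 1)) \<in> basic_cocycles n"
      by (auto simp: basic_cocycles_def)
    moreover have "l + (- (int n + 1), - (int n + 1)) = (i - (int n + 1), i - (int n + 1))"
      by (simp add: l)
    ultimately have "basic_span n
        (\<lambda>a b. pm_scale c (mon l * bimult carry (- (int n + 1), - (int n + 1)) a b))"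
      unfolding mon_mult_bimult by (intro basic_span_scale basic_span_basic) simp
    from basic_span_add[OF this *(1)[unfolded carry_coeff_def]]
    have "carry_coeff n (pm_scale c (mon l) + r)"
      by (simp add: carry_coeff_def distrib_right pm_scale_mult_left)
    then show ?thesis
      using * by (intro exI[of _ "pm_scale c (mon l) + r"] exI[of _ p] exI[of _ q]) simp
  qed
qed

section \<open>Antisymmetric parts of cocycles\<close>

text \<open>
  The values at the first two generators determine the value at the third, since \<open>S\<^sub>1 + S\<^sub>3 = (n + 1) S\<^sub>2\<close>.
\<close>

lemma additive_on_Lambda:
  fixes c :: "int \<times> int \<Rightarrow> 'a::ring_1"
  assumes add: "\<And>l m. l \<in> Lambda n \<Longrightarrow> m \<in> Lambda n \<Longrightarrow> c (l + m) = c l + c m"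
    and l: "l \<in> Lambda n"
  shows "c l = of_int (fst l) * c (1, 1) + of_int (snd l - fst l) * c (0, 1)"
proof -
  have gens: "(0, 1) \<in> Lambda n" "(1, 1) \<in> Lambda n" "(int n + 1, int n) \<in> Lambda n"
    by (simp_all add: Lambda_iff alpha_def beta_def algebra_simps)
  have c0: "c 0 = 0" using add[OF Lambda.zero Lambda.zero] by simp
  have pow: "c (int j, int j) = of_nat j * c (1, 1)" for j
  proof (induction j)
    case 0
    then show ?case using c0 by (simp add: zero_prod_def)
  next
    case (Suc j)
    have "(int j, int j) \<in> Lambda n" by (simp add: Lambda_iff)
    from add[OF gens(2) this] Suc show ?case by (simp add: algebra_simps)
  qed
  have "c (0, 1) + c (int n + 1, int n) = of_nat (n + 1) * c (1, 1)"
    using add[OF gens(1,3)] pow[of "n + 1"] by (simp add: add.commute)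
  then have c3: "c (int n + 1, int n) = of_int (int n + 1) * c (1, 1) - c (0, 1)"
    by (simp add: algebra_simps)
  show ?thesis
    using l
  proof (induction rule: Lambda.induct)
    case zero
    show ?case by (simp add: c0)
  next
    case (gen s v)
    then have "s \<in> Lambda n" using gens by auto
    have s: "c s = of_int (fst s) * c (1, 1) + of_int (snd s - fst s) * c (0, 1)"
      using gen(1) by (auto simp: c3)
    show ?case
      unfolding add[OF \<open>s \<in> Lambda n\<close> gen(2)] s gen(3) by (simp add: algebra_simps)
  qed
qed

lemma A_n_divide:
  assumes "mon l * h \<in> A_n n" "k \<in> Poly_Mapping.keys h"
  shows "l + k \<in> Lambda n"
proof -
  have "k \<in> Poly_Mapping.keys (mon (- l) * (mon l * h))"
    using assms(2) by (simp add: mon_cancel)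
  then obtain j m where "j \<in> Poly_Mapping.keys (mon (- l) :: _ \<Rightarrow>\<^sub>0 'a)"
      "m \<in> Poly_Mapping.keys (mon l * h)" "k = j + m"
    using keys_mult[of "mon (- l)" "mon l * h"] by blast
  then show ?thesis using assms(1) by (auto simp: A_n_def)
qed

text \<open>
  The antisymmetric part \<open>u\<close> is a biderivation. Dividing \<open>u\<close> of two monomials by the product of the
  monomials makes it biadditive and alternating in the exponents, hence equal to \<open>h0\<close> times their
  determinant. The coefficient \<open>h = z h0\<close> belongs to \<open>A\<^sub>n\<close> because \<open>x h\<close> and \<open>y h\<close> are values of \<open>u\<close>.
\<close>

lemma antisymmetric_part_basic_span:
  fixes f :: "(int \<times> int \<Rightarrow>\<^sub>0 'k) \<Rightarrow> (int \<times> int \<Rightarrow>\<^sub>0 'k) \<Rightarrow> (int \<times> int \<Rightarrow>\<^sub>0 'k::field_char_0)"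
  assumes f: "A_n.cocycle2 n f"
  shows "\<exists>g. basic_span n g \<and> (\<forall>l\<in>Lambda n. \<forall>m\<in>Lambda n.
    f (mon l) (mon m) - f (mon m) (mon l) = g (mon l) (mon m))"
proof -
  have bil: "A_n.bilinear_op n f" using f by (simp add: A_n.cocycle2_def)
  define u where "u a b = f a b - f b a" for a b
  have u_closed: "u a b \<in> A_n n" if "a \<in> A_n n" "b \<in> A_n n" for a b
    using that A_n.bilinear_op_closed[OF bil] by (simp add: u_def)
  have der: "u (a * b) c = a * u b c + u a c * b" if "a \<in> A_n n" "b \<in> A_n n" "c \<in> A_n n" for a b c
  proof -
    have "u (a * b) c - (a * u b c + u a c * b)
        = A_n.delta2 f a c b - A_n.delta2 f a b c - A_n.delta2 f c a b"
      by (simp add: u_def A_n.delta2_def algebra_simps)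
    also have "\<dots> = 0" using f that by (simp add: A_n.cocycle2_def)
    finally show ?thesis by simp
  qed
  define \<beta> where "\<beta> l m = mon (- l - m) * u (mon l) (mon m)" for l m
  have u_eq: "u (mon l) (mon m) = mon (l + m) * \<beta> l m" for l m
    by (simp add: \<beta>_def mult.assoc[symmetric] mon_mult)
  have anti: "\<beta> m l = - \<beta> l m" for l m
  proof -
    have "- m - l = - l - m" by simp
    then have "mon (- m - l) = (mon (- l - m) :: _ \<Rightarrow>\<^sub>0 'k)" by (rule arg_cong)
    then show ?thesis unfolding \<beta>_def u_def by (simp only: right_diff_distrib minus_diff_eq)
  qed
  have diag: "\<beta> l l = 0" for l
    by (simp add: \<beta>_def u_def)
  have add: "\<beta> (l + l') m = \<beta> l m + \<beta> l' m"
    if "l \<in> Lambda n" "l' \<in> Lambda n" "m \<in> Lambda n" for l l' m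
  proof -
    have "u (mon (l + l')) (mon m) = mon l * u (mon l') (mon m) + u (mon l) (mon m) * mon l'"
      using der[of "mon l" "mon l'" "mon m"] that by (simp add: monomial_in_A_n mon_mult)
    also have "\<dots> = mon (l + l' + m) * (\<beta> l' m + \<beta> l m)"
      by (simp add: u_eq mon_mult[symmetric] algebra_simps)
    finally show ?thesis
      by (simp add: \<beta>_def[of "l + l'"] mult.assoc[symmetric] mon_mult)
  qed
  define h0 where "h0 = \<beta> (1, 1) (0, 1)"
  have gens: "(0, 1) \<in> Lambda n" "(1, 1) \<in> Lambda n" "(int n + 1, int n) \<in> Lambda n"
    by (simp_all add: Lambda_iff alpha_def beta_def algebra_simps)
  have gen_val: "\<beta> (1, 1) m = of_int (snd m - fst m) * h0" "\<beta> (0, 1) m = - of_int (fst m) * h0"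
    if m: "m \<in> Lambda n" for m
  proof -
    have "\<beta> m l = of_int (fst m) * \<beta> (1, 1) l + of_int (snd m - fst m) * \<beta> (0, 1) l"
      if "l \<in> Lambda n" for l
      using additive_on_Lambda[of n "\<lambda>l'. \<beta> l' l", OF add m] that by simp
    from this[OF gens(1)] this[OF gens(2)]
    show "\<beta> (1, 1) m = of_int (snd m - fst m) * h0" "\<beta> (0, 1) m = - of_int (fst m) * h0"
      using anti[of "(1, 1)" m] anti[of "(0, 1)" m] anti[of "(1, 1)" "(0, 1)"]
      by (simp_all add: diag h0_def)
  qed
  have \<beta>_eq: "\<beta> l m = of_int (omega l m) * h0" if "l \<in> Lambda n" "m \<in> Lambda n" for l m
    using additive_on_Lambda[of n "\<lambda>l'. \<beta> l' m", OF add that(1)] that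
    by (simp add: gen_val omega_def algebra_simps)
  define h where "h = mon (1, 1) * h0"
  have "u (mon (1, 1)) (mon (0, 1)) = mon (0, 1) * h"
    unfolding u_eq by (simp add: h_def h0_def mult.assoc[symmetric] mon_mult)
  then have h1: "mon (0, 1) * h \<in> A_n n"
    by (metis u_closed monomial_in_A_n gens(1,2))
  have "u (mon (int n + 1, int n)) (mon (1, 1)) = mon (int n + 1, int n) * h"
    unfolding u_eq \<beta>_eq[OF gens(3,2)] by (simp add: omega_def h_def mult.assoc[symmetric] mon_mult)
  then have h2: "mon (int n + 1, int n) * h \<in> A_n n"
    by (metis u_closed monomial_in_A_n gens(3,2))
  \<comment> \<open>As \<open>alpha\<close> vanishes at \<open>x\<close> and \<open>beta\<close> at \<open>y\<close>, an exponent lies in the cone if its sums with those of \<open>x\<close> and \<open>y\<close> do.\<close>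
  have "h \<in> A_n n"
    unfolding A_n_def mem_Collect_eq
  proof
    fix k assume k: "k \<in> Poly_Mapping.keys h"
    from A_n_divide[OF h1 k] A_n_divide[OF h2 k] show "k \<in> Lambda n"
      by (auto simp: Lambda_iff alpha_def beta_def algebra_simps)
  qed
  from basic_span_omega[OF this] show ?thesis
  proof (intro exI[of _ "\<lambda>a b. h * bimult omega (- (1, 1)) a b"] conjI ballI)
    fix l m assume lm: "l \<in> Lambda n" "m \<in> Lambda n"
    have "f (mon l) (mon m) - f (mon m) (mon l) = mon (l + m) * (of_int (omega l m) * h0)"
      using u_eq[of l m] \<beta>_eq[OF lm] by (simp add: u_def)
    also have "\<dots> = h * bimult omega (- (1, 1)) (mon l) (mon m)"
    proof -
      have "bimult omega (- (1, 1)) (mon l) (mon m)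
          = mon (l + m) * (mon (- (1, 1)) * (of_int (omega l m) :: _ \<Rightarrow>\<^sub>0 'k))"
        by (simp add: single_of_int[symmetric] mult_single del: single_of_int)
      then have "h * bimult omega (- (1, 1)) (mon l) (mon m)
          = mon (l + m) * (of_int (omega l m) * (mon (- (1, 1)) * h))"
        by (simp only: ac_simps)
      then show ?thesis unfolding h_def mon_cancel by (rule sym)
    qed
    finally show "f (mon l) (mon m) - f (mon m) (mon l) = h * bimult omega (- (1, 1)) (mon l) (mon m)" .
  qed
qed

section \<open>Symmetric parts of cocycles\<close>

text \<open>
  The value of a symmetric cocycle on \<open>mon l\<close>, \<open>mon m\<close> is \<open>mon (l + m) * \<sigma> l m\<close>. The pair \<open>(l, k)\<close> stands for
  the lift \<open>mon l (1 + t k)\<close> of the monomial \<open>mon l\<close> to \<open>A\<^sub>n[t] / (t\<^sup>2)\<close> with the deformed product. The carrier consists of the lifts with coefficients in \<open>A\<^sub>n\<close>. The unit of the deformed product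
  is \<open>1 - t \<sigma> 0 0\<close>.
\<close>

definition ext_monoid :: "nat \<Rightarrow> (int \<times> int \<Rightarrow> int \<times> int \<Rightarrow> int \<times> int \<Rightarrow>\<^sub>0 'k::field) \<Rightarrow>
    ((int \<times> int) \<times> (int \<times> int \<Rightarrow>\<^sub>0 'k)) monoid" where
  "ext_monoid n \<sigma> =
     \<lparr>carrier = {P. fst P \<in> Lambda n \<and> mon (fst P) * snd P \<in> A_n n},
      monoid.mult = (\<lambda>P Q. (fst P + fst Q, snd P + snd Q + \<sigma> (fst P) (fst Q))),
      one = (0, - \<sigma> 0 0)\<rparr>"

locale symmetric_extension =
  fixes n :: nat and \<sigma> :: "int \<times> int \<Rightarrow> int \<times> int \<Rightarrow> int \<times> int \<Rightarrow>\<^sub>0 'k::field_char_0"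
  assumes sym: "\<And>l m. l \<in> Lambda n \<Longrightarrow> m \<in> Lambda n \<Longrightarrow> \<sigma> l m = \<sigma> m l"
    and cocycle: "\<And>l m r. l \<in> Lambda n \<Longrightarrow> m \<in> Lambda n \<Longrightarrow> r \<in> Lambda n \<Longrightarrow>
      \<sigma> l m + \<sigma> (l + m) r = \<sigma> m r + \<sigma> l (m + r)"
    and integral: "\<And>l m. l \<in> Lambda n \<Longrightarrow> m \<in> Lambda n \<Longrightarrow> mon (l + m) * \<sigma> l m \<in> A_n n"
begin

abbreviation G where "G \<equiv> ext_monoid n \<sigma>"

lemma G_simps:
  "P \<in> carrier G \<longleftrightarrow> fst P \<in> Lambda n \<and> mon (fst P) * snd P \<in> A_n n"
  "P \<otimes>\<^bsub>G\<^esub> Q = (fst P + fst Q, snd P + snd Q + \<sigma> (fst P) (fst Q))"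
  "\<one>\<^bsub>G\<^esub> = (0, - \<sigma> 0 0)"
  by (simp_all add: ext_monoid_def)

lemma \<sigma>_zero: "l \<in> Lambda n \<Longrightarrow> \<sigma> 0 l = \<sigma> 0 0"
  using cocycle[of 0 0 l] Lambda.zero[of n] by simp

sublocale G: comm_monoid G
proof (rule comm_monoidI)
  show "P \<otimes>\<^bsub>G\<^esub> Q \<in> carrier G" if "P \<in> carrier G" "Q \<in> carrier G" for P Q
  proof -
    have "mon (fst P + fst Q) * (snd P + snd Q + \<sigma> (fst P) (fst Q))
        = mon (fst Q) * (mon (fst P) * snd P) + mon (fst P) * (mon (fst Q) * snd Q)
          + mon (fst P + fst Q) * \<sigma> (fst P) (fst Q)"
      by (simp add: mult.assoc[symmetric] mon_mult distrib_left add.commute)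
    also have "\<dots> \<in> A_n n"
      by (rule A_n.A_closed(2)[OF A_n.A_closed(2)[OF A_n.A_closed(6) A_n.A_closed(6)]])
        (use that integral[of "fst P" "fst Q"] in \<open>simp_all add: G_simps monomial_in_A_n\<close>)
    finally show ?thesis
      using that by (simp add: G_simps Lambda_add)
  qed
  show "\<one>\<^bsub>G\<^esub> \<in> carrier G"
    using integral[OF Lambda.zero Lambda.zero] A_n.A_closed(4)[of "\<sigma> 0 0" n]
    by (simp add: G_simps Lambda.zero)
  show "P \<otimes>\<^bsub>G\<^esub> Q \<otimes>\<^bsub>G\<^esub> R = P \<otimes>\<^bsub>G\<^esub> (Q \<otimes>\<^bsub>G\<^esub> R)"
    if "P \<in> carrier G" "Q \<in> carrier G" "R \<in> carrier G" for P Q R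
    using that cocycle[of "fst P" "fst Q" "fst R"] by (simp add: G_simps algebra_simps)
  show "\<one>\<^bsub>G\<^esub> \<otimes>\<^bsub>G\<^esub> P = P" if "P \<in> carrier G" for P
    using that \<sigma>_zero by (simp add: G_simps)
  show "P \<otimes>\<^bsub>G\<^esub> Q = Q \<otimes>\<^bsub>G\<^esub> P" if "P \<in> carrier G" "Q \<in> carrier G" for P Q
    using that sym by (simp add: G_simps add.commute)
qed

lemma fst_pow: "fst (P [^]\<^bsub>G\<^esub> (j :: nat)) = (int j * fst (fst P), int j * snd (fst P))"
  by (induction j) (simp_all add: G_simps zero_prod_def prod_eq_iff algebra_simps)

text \<open>
  The factor \<open>1 + t \<gamma>\<close> is central and multiplicative, so it can be taken out of a power as
  \<open>1 + t j \<gamma>\<close>.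
\<close>

lemma pow_shift:
  assumes U: "U \<in> carrier G" and V: "V \<in> carrier G" and UV: "U = (fst V, snd V + \<gamma>)"
    and Q: "Q \<in> carrier G"
  shows "U [^]\<^bsub>G\<^esub> (j :: nat) \<otimes>\<^bsub>G\<^esub> Q
    = (fst (V [^]\<^bsub>G\<^esub> j \<otimes>\<^bsub>G\<^esub> Q), snd (V [^]\<^bsub>G\<^esub> j \<otimes>\<^bsub>G\<^esub> Q) + of_nat j * \<gamma>)"
  using Q
proof (induction j arbitrary: Q)
  case 0
  then show ?case by simp
next
  case (Suc j)
  have "U [^]\<^bsub>G\<^esub> Suc j \<otimes>\<^bsub>G\<^esub> Q = U [^]\<^bsub>G\<^esub> j \<otimes>\<^bsub>G\<^esub> (U \<otimes>\<^bsub>G\<^esub> Q)"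
    using U Suc.prems by (simp add: G.m_assoc)
  also have "\<dots> = (fst (V [^]\<^bsub>G\<^esub> j \<otimes>\<^bsub>G\<^esub> (U \<otimes>\<^bsub>G\<^esub> Q)), snd (V [^]\<^bsub>G\<^esub> j \<otimes>\<^bsub>G\<^esub> (U \<otimes>\<^bsub>G\<^esub> Q)) + of_nat j * \<gamma>)"
    using U Suc.prems by (intro Suc.IH G.m_closed)
  also have "U \<otimes>\<^bsub>G\<^esub> Q = (fst (V \<otimes>\<^bsub>G\<^esub> Q), snd (V \<otimes>\<^bsub>G\<^esub> Q) + \<gamma>)"
    by (subst UV) (simp add: G_simps)
  finally have "U [^]\<^bsub>G\<^esub> Suc j \<otimes>\<^bsub>G\<^esub> Q
      = (fst (V [^]\<^bsub>G\<^esub> j \<otimes>\<^bsub>G\<^esub> (fst (V \<otimes>\<^bsub>G\<^esub> Q), snd (V \<otimes>\<^bsub>G\<^esub> Q) + \<gamma>)),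
         snd (V [^]\<^bsub>G\<^esub> j \<otimes>\<^bsub>G\<^esub> (fst (V \<otimes>\<^bsub>G\<^esub> Q), snd (V \<otimes>\<^bsub>G\<^esub> Q) + \<gamma>)) + of_nat j * \<gamma>)" .
  also have "\<dots> = (fst (V [^]\<^bsub>G\<^esub> j \<otimes>\<^bsub>G\<^esub> (V \<otimes>\<^bsub>G\<^esub> Q)), snd (V [^]\<^bsub>G\<^esub> j \<otimes>\<^bsub>G\<^esub> (V \<otimes>\<^bsub>G\<^esub> Q)) + of_nat (Suc j) * \<gamma>)"
    by (simp add: G_simps(2)[of "V [^]\<^bsub>G\<^esub> j"] distrib_right add.assoc add.left_commute)
  also have "V [^]\<^bsub>G\<^esub> j \<otimes>\<^bsub>G\<^esub> (V \<otimes>\<^bsub>G\<^esub> Q) = V [^]\<^bsub>G\<^esub> Suc j \<otimes>\<^bsub>G\<^esub> Q"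
    using V Suc.prems by (simp add: G.m_assoc)
  finally show ?case .
qed

text \<open>
  The lift of the monomial \<open>l\<close> that is obtained from lifts of \<open>x\<close>, \<open>y\<close>, \<open>z\<close> by writing \<open>l\<close> as \<open>x\<^sup>a z\<^sup>c\<close> or
  \<open>y\<^sup>b z\<^sup>c\<close>.
\<close>

definition sect where
  "sect X Y Z l = X [^]\<^bsub>G\<^esub> nat (max 0 (snd l - fst l)) \<otimes>\<^bsub>G\<^esub> Y [^]\<^bsub>G\<^esub> nat (y_exp l)
     \<otimes>\<^bsub>G\<^esub> Z [^]\<^bsub>G\<^esub> nat (fst l - (int n + 1) * y_exp l)"

lemma exponents_nonneg: "l \<in> Lambda n \<Longrightarrow> 0 \<le> fst l - (int n + 1) * y_exp l"
  by (simp add: alpha_beta_y_exp Lambda_iff) (simp add: alpha_def)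

text \<open>
  Collecting powers of the three lifts leaves \<open>carry l m\<close> superfluous factors \<open>X Y\<close>. Each of them is
  \<open>Z\<^sup>n\<^sup>+\<^sup>1\<close> times the defect \<open>1 + t \<gamma>\<close>.
\<close>

lemma sect_mult:
  assumes X: "X \<in> carrier G" and Y: "Y \<in> carrier G" and Z: "Z \<in> carrier G"
    and \<gamma>: "X \<otimes>\<^bsub>G\<^esub> Y = (fst (Z [^]\<^bsub>G\<^esub> (n + 1)), snd (Z [^]\<^bsub>G\<^esub> (n + 1)) + \<gamma>)"
    and l: "l \<in> Lambda n" and m: "m \<in> Lambda n"
  shows "sect X Y Z l \<otimes>\<^bsub>G\<^esub> sect X Y Z m
    = (fst (sect X Y Z (l + m)), snd (sect X Y Z (l + m)) + of_int (carry l m) * \<gamma>)"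
proof -
  note cl = X Y Z G.nat_pow_closed G.m_closed
  define a b c where "a l = nat (max 0 (snd l - fst l))" and "b l = nat (y_exp l)"
    and "c l = nat (fst l - (int n + 1) * y_exp l)" for l :: "int \<times> int"
  define N where "N = nat (carry l m)"
  have N: "carry l m = int N" using carry_bounds(1)[OF l m] by (simp add: N_def)
  have lm: "l + m \<in> Lambda n" by (rule Lambda_add[OF l m])
  have exps: "a l + a m = N + a (l + m)" "b l + b m = N + b (l + m)"
  proof -
    have "int (a l + a m) = int (N + a (l + m))"
      unfolding of_nat_add N[symmetric] by (simp add: a_def carry_def y_exp_def)
    then show "a l + a m = N + a (l + m)" by (simp only: of_nat_eq_iff)
    have "int (b l + b m) = int (N + b (l + m))"
      unfolding of_nat_add N[symmetric] by (simp add: b_def carry_def y_exp_def)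
    then show "b l + b m = N + b (l + m)" by (simp only: of_nat_eq_iff)
  qed
  have "int (c (l + m)) = int ((n + 1) * N + (c l + c m))"
    using exponents_nonneg[OF l] exponents_nonneg[OF m] exponents_nonneg[OF lm]
    unfolding of_nat_add of_nat_mult N[symmetric] by (simp add: c_def carry_def algebra_simps)
  then have exps_c: "c (l + m) = (n + 1) * N + (c l + c m)" by (simp only: of_nat_eq_iff)
  let ?W = "X [^]\<^bsub>G\<^esub> a (l + m) \<otimes>\<^bsub>G\<^esub> Y [^]\<^bsub>G\<^esub> b (l + m) \<otimes>\<^bsub>G\<^esub> Z [^]\<^bsub>G\<^esub> (c l + c m)"
  have "sect X Y Z l \<otimes>\<^bsub>G\<^esub> sect X Y Z m
      = (X [^]\<^bsub>G\<^esub> a l \<otimes>\<^bsub>G\<^esub> X [^]\<^bsub>G\<^esub> a m) \<otimes>\<^bsub>G\<^esub> (Y [^]\<^bsub>G\<^esub> b l \<otimes>\<^bsub>G\<^esub> Y [^]\<^bsub>G\<^esub> b m) \<otimes>\<^bsub>G\<^esub>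
        (Z [^]\<^bsub>G\<^esub> c l \<otimes>\<^bsub>G\<^esub> Z [^]\<^bsub>G\<^esub> c m)"
    unfolding sect_def a_def[symmetric] b_def[symmetric] c_def[symmetric]
    by (simp add: G.m_ac cl)
  also have "\<dots> = X [^]\<^bsub>G\<^esub> (N + a (l + m)) \<otimes>\<^bsub>G\<^esub> Y [^]\<^bsub>G\<^esub> (N + b (l + m)) \<otimes>\<^bsub>G\<^esub> Z [^]\<^bsub>G\<^esub> (c l + c m)"
    unfolding G.nat_pow_mult[OF X] G.nat_pow_mult[OF Y] G.nat_pow_mult[OF Z] exps ..
  also have "\<dots> = (X [^]\<^bsub>G\<^esub> N \<otimes>\<^bsub>G\<^esub> Y [^]\<^bsub>G\<^esub> N) \<otimes>\<^bsub>G\<^esub> ?W"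
    unfolding G.nat_pow_mult[OF X, symmetric] G.nat_pow_mult[OF Y, symmetric]
    by (simp add: G.m_ac cl)
  also have "X [^]\<^bsub>G\<^esub> N \<otimes>\<^bsub>G\<^esub> Y [^]\<^bsub>G\<^esub> N = (X \<otimes>\<^bsub>G\<^esub> Y) [^]\<^bsub>G\<^esub> N"
    by (simp add: G.nat_pow_distrib X Y)
  also have "\<dots> \<otimes>\<^bsub>G\<^esub> ?W = (fst ((Z [^]\<^bsub>G\<^esub> (n + 1)) [^]\<^bsub>G\<^esub> N \<otimes>\<^bsub>G\<^esub> ?W),
      snd ((Z [^]\<^bsub>G\<^esub> (n + 1)) [^]\<^bsub>G\<^esub> N \<otimes>\<^bsub>G\<^esub> ?W) + of_nat N * \<gamma>)"
    by (intro pow_shift \<gamma> cl)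
  also have "(Z [^]\<^bsub>G\<^esub> (n + 1)) [^]\<^bsub>G\<^esub> N \<otimes>\<^bsub>G\<^esub> ?W = sect X Y Z (l + m)"
  proof -
    have "(Z [^]\<^bsub>G\<^esub> (n + 1)) [^]\<^bsub>G\<^esub> N = Z [^]\<^bsub>G\<^esub> ((n + 1) * N)"
      by (rule G.nat_pow_pow[OF Z])
    moreover have "Z [^]\<^bsub>G\<^esub> c (l + m) = Z [^]\<^bsub>G\<^esub> ((n + 1) * N) \<otimes>\<^bsub>G\<^esub> Z [^]\<^bsub>G\<^esub> (c l + c m)"
      unfolding exps_c by (rule G.nat_pow_mult[OF Z, symmetric])
    ultimately show ?thesis
      unfolding sect_def a_def[symmetric] b_def[symmetric] c_def[symmetric]
      by (simp add: G.m_ac cl del: G.nat_pow_Suc)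
  qed
  finally show ?thesis by (simp add: N)
qed

lemma fst_sect:
  assumes "l \<in> Lambda n" "fst X = (0, 1)" "fst Y = (int n + 1, int n)" "fst Z = (1, 1)"
  shows "fst (sect X Y Z l) = l"
  using exponents_nonneg[OF assms(1)]
  unfolding sect_def G_simps(2) fst_pow fst_conv assms(2-4)
  by (auto simp: prod_eq_iff y_exp_def max_def algebra_simps)

text \<open>
  Let \<open>\<Phi>\<close> be given by the lifts \<open>sect\<close>. Then the cocycle differs from a coboundary only by the defect of
  \<open>x y = z\<^sup>n\<^sup>+\<^sup>1\<close>. The lifts of \<open>x\<close> and \<open>y\<close> are chosen such that the part of the defect in the ideal
  \<open>(x, y)\<close> is cancelled.
\<close>

lemma split_up_to_carry:
  "\<exists>\<Phi> r. (\<forall>l\<in>Lambda n. \<Phi> l \<in> A_n n) \<and> carry_coeff n r \<and>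
    (\<forall>l\<in>Lambda n. \<forall>m\<in>Lambda n. mon (l + m) * \<sigma> l m = \<Phi> (l + m) - mon l * \<Phi> m - \<Phi> l * mon m
      + r * bimult carry (- (int n + 1), - (int n + 1)) (mon l) (mon m))"
proof -
  let ?x = "(0, 1) :: int \<times> int" and ?y = "(int n + 1, int n)" and ?N = "(int n + 1, int n + 1)"
  have gens: "?x \<in> Lambda n" "(1, 1) \<in> Lambda n" "?y \<in> Lambda n"
    by (simp_all add: Lambda_iff alpha_def beta_def algebra_simps)
  define Z where "Z = ((1, 1) :: int \<times> int, 0 :: int \<times> int \<Rightarrow>\<^sub>0 'k)"
  have Z: "Z \<in> carrier G" by (simp add: Z_def G_simps gens)
  define w where "w = snd (Z [^]\<^bsub>G\<^esub> (n + 1))"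
  have fst_ZN: "fst (Z [^]\<^bsub>G\<^esub> (n + 1)) = ?N"
    unfolding fst_pow by (simp add: Z_def)
  have "mon ?N * w \<in> A_n n"
    using G.nat_pow_closed[OF Z, of "n + 1"] unfolding G_simps(1) fst_ZN w_def by blast
  moreover have "mon ?N * \<sigma> ?x ?y \<in> A_n n"
    using integral[OF gens(1,3)] by (simp add: add.commute)
  ultimately have "mon ?N * (\<sigma> ?x ?y - w) \<in> A_n n"
    unfolding right_diff_distrib by (intro A_n.A_closed(3))
  then obtain r p q where r: "carry_coeff n r" and p: "p \<in> A_n n" and q: "q \<in> A_n n"
    and dec: "mon ?N * (\<sigma> ?x ?y - w) = r + mon ?x * p + mon ?y * q"
    using A_n_decomp by blast
  \<comment> \<open>In \<open>X Y\<close> these corrections contribute \<open>- y q\<close> and \<open>- x p\<close>.\<close>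
  define X where "X = (?x, - (mon (- ?x) * q))"
  define Y where "Y = (?y, - (mon (- ?y) * p))"
  have X: "X \<in> carrier G" and Y: "Y \<in> carrier G"
    using p q gens by (simp_all add: X_def Y_def G_simps mult.assoc[symmetric] mon_mult
        A_n.A_closed del: uminus_Pair)
  define \<gamma> where "\<gamma> = mon (- ?N) * r"
  have \<gamma>: "X \<otimes>\<^bsub>G\<^esub> Y = (fst (Z [^]\<^bsub>G\<^esub> (n + 1)), snd (Z [^]\<^bsub>G\<^esub> (n + 1)) + \<gamma>)"
  proof -
    have "\<sigma> ?x ?y - w = mon (- ?N) * (r + mon ?x * p + mon ?y * q)"
      unfolding dec[symmetric] by (rule mon_cancel(2)[symmetric])
    also have "\<dots> = \<gamma> + mon (- ?y) * p + mon (- ?x) * q"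
      by (simp add: \<gamma>_def distrib_left mult.assoc[symmetric] mon_mult)
    finally show ?thesis
      unfolding fst_ZN w_def[symmetric] by (simp add: G_simps X_def Y_def algebra_simps)
  qed
  have sc: "sect X Y Z l \<in> carrier G" for l
    unfolding sect_def by (intro G.m_closed G.nat_pow_closed X Y Z)
  have fs: "fst (sect X Y Z l) = l" if "l \<in> Lambda n" for l
    by (rule fst_sect[OF that]) (simp_all add: X_def Y_def Z_def)
  define \<tau> where "\<tau> l = snd (sect X Y Z l)" for l
  have \<tau>: "\<tau> l + \<tau> m + \<sigma> l m = \<tau> (l + m) + of_int (carry l m) * \<gamma>"
    if "l \<in> Lambda n" "m \<in> Lambda n" for l m
    using arg_cong[OF sect_mult[OF X Y Z \<gamma> that], of snd] that
    by (simp add: G_simps fs \<tau>_def)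
  show ?thesis
  proof (intro exI[of _ "\<lambda>l. mon l * \<tau> l"] exI[of _ r] conjI ballI r)
    show "mon l * \<tau> l \<in> A_n n" if "l \<in> Lambda n" for l
      using sc[of l] by (simp add: G_simps fs[OF that] \<tau>_def)
    fix l m assume lm: "l \<in> Lambda n" "m \<in> Lambda n"
    have \<sigma>_eq: "\<sigma> l m = \<tau> (l + m) + of_int (carry l m) * \<gamma> - \<tau> l - \<tau> m"
      using \<tau>[OF lm] by (simp add: algebra_simps)
    have "mon (l + m) * \<sigma> l m = mon (l + m) * \<tau> (l + m) - mon l * mon m * \<tau> m
        - mon l * mon m * \<tau> l + mon (l + m) * (of_int (carry l m) * \<gamma>)"
      unfolding \<sigma>_eq by (simp add: mon_mult algebra_simps)
    also have "mon (l + m) * (of_int (carry l m) * \<gamma>)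
        = r * bimult carry (- (int n + 1), - (int n + 1)) (mon l) (mon m)"
    proof -
      have "bimult carry (- (int n + 1), - (int n + 1)) (mon l) (mon m)
          = mon (l + m) * (mon (- ?N) * (of_int (carry l m) :: _ \<Rightarrow>\<^sub>0 'k))"
        by (simp add: single_of_int[symmetric] mult_single del: single_of_int)
      then show ?thesis by (simp add: \<gamma>_def ac_simps)
    qed
    finally show "mon (l + m) * \<sigma> l m = mon (l + m) * \<tau> (l + m) - mon l * (mon m * \<tau> m)
        - mon l * \<tau> l * mon m + r * bimult carry (- (int n + 1), - (int n + 1)) (mon l) (mon m)"
      by (simp add: ac_simps)
  qed
qed

end

lemma symmetric_part_basic_span:
  fixes f :: "(int \<times> int \<Rightarrow>\<^sub>0 'k) \<Rightarrow> (int \<times> int \<Rightarrow>\<^sub>0 'k) \<Rightarrow> (int \<times> int \<Rightarrow>\<^sub>0 'k::field_char_0)"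
  assumes f: "A_n.cocycle2 n f"
  shows "\<exists>\<phi> g. A_n.linear_op n \<phi> \<and> basic_span n g \<and> (\<forall>l\<in>Lambda n. \<forall>m\<in>Lambda n.
    f (mon l) (mon m) + f (mon m) (mon l) = A_n.delta1 \<phi> (mon l) (mon m) + g (mon l) (mon m))"
proof -
  have bil: "A_n.bilinear_op n f" using f by (simp add: A_n.cocycle2_def)
  define s where "s a b = f a b + f b a" for a b
  define \<sigma> where "\<sigma> l m = mon (- (l + m)) * s (mon l) (mon m)" for l m
  have s_eq: "s (mon l) (mon m) = mon (l + m) * \<sigma> l m" for l m
    unfolding \<sigma>_def by (rule mon_cancel(1)[symmetric])
  interpret symmetric_extension n \<sigma>
  proof
    show "\<sigma> l m = \<sigma> m l" for l m
      by (simp add: \<sigma>_def s_def add.commute)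
    show "mon (l + m) * \<sigma> l m \<in> A_n n" if "l \<in> Lambda n" "m \<in> Lambda n" for l m
      unfolding s_eq[symmetric] s_def using that
      by (intro A_n.A_closed A_n.bilinear_op_closed[OF bil] monomial_in_A_n)
    fix l m r assume lmr: "l \<in> Lambda n" "m \<in> Lambda n" "r \<in> Lambda n"
    let ?a = "mon l :: _ \<Rightarrow>\<^sub>0 'k" and ?b = "mon m :: _ \<Rightarrow>\<^sub>0 'k" and ?c = "mon r :: _ \<Rightarrow>\<^sub>0 'k"
    have "A_n.delta2 s ?a ?b ?c = A_n.delta2 f ?a ?b ?c - A_n.delta2 f ?c ?b ?a"
      by (simp add: s_def A_n.delta2_def algebra_simps)
    also have "\<dots> = 0" using f lmr by (simp add: A_n.cocycle2_def monomial_in_A_n)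
    finally have "?a * s ?b ?c - s (mon (l + m)) ?c + s ?a (mon (m + r)) - s ?a ?b * ?c = 0"
      by (simp add: A_n.delta2_def mon_mult)
    then have "mon (l + m + r) * (\<sigma> m r - \<sigma> (l + m) r + \<sigma> l (m + r) - \<sigma> l m) = 0"
      unfolding s_eq by (simp add: mon_mult[symmetric] algebra_simps)
    then have "mon (- (l + m + r)) * (mon (l + m + r) * (\<sigma> m r - \<sigma> (l + m) r + \<sigma> l (m + r) - \<sigma> l m)) = 0"
      by simp
    then show "\<sigma> l m + \<sigma> (l + m) r = \<sigma> m r + \<sigma> l (m + r)"
      unfolding mon_cancel by (simp add: algebra_simps)
  qed
  obtain \<Phi> r where \<Phi>: "\<And>l. l \<in> Lambda n \<Longrightarrow> \<Phi> l \<in> A_n n" and r: "carry_coeff n r"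
    and eq: "\<And>l m. l \<in> Lambda n \<Longrightarrow> m \<in> Lambda n \<Longrightarrow>
      mon (l + m) * \<sigma> l m = \<Phi> (l + m) - mon l * \<Phi> m - \<Phi> l * mon m
        + r * bimult carry (- (int n + 1), - (int n + 1)) (mon l) (mon m)"
    using split_up_to_carry by blast
  show ?thesis
  proof (intro exI conjI ballI)
    show "A_n.linear_op n (lin_ext (\<lambda>l. - \<Phi> l))"
      using \<Phi> by (intro linear_lin_ext) (simp add: A_n.A_closed)
    show "basic_span n (\<lambda>a b. r * bimult carry (- (int n + 1), - (int n + 1)) a b)"
      using r by (simp add: carry_coeff_def)
    fix l m assume lm: "l \<in> Lambda n" "m \<in> Lambda n"
    have "A_n.delta1 (lin_ext (\<lambda>l. - \<Phi> l)) (mon l) (mon m) = \<Phi> (l + m) - mon l * \<Phi> m - \<Phi> l * mon m"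
      by (simp add: A_n.delta1_def mon_mult pm_scale_simps)
    then show "f (mon l) (mon m) + f (mon m) (mon l) = A_n.delta1 (lin_ext (\<lambda>l. - \<Phi> l)) (mon l) (mon m)
        + r * bimult carry (- (int n + 1), - (int n + 1)) (mon l) (mon m)"
      using eq[OF lm] unfolding s_eq[symmetric] s_def by simp
  qed
qed

section \<open>Vanishing of the product\<close>

text \<open>
  A cocycle is half the sum of its symmetric and its antisymmetric part.
\<close>

lemma cocycle_cohomologous_basic_span:
  fixes f :: "(int \<times> int \<Rightarrow>\<^sub>0 'k) \<Rightarrow> (int \<times> int \<Rightarrow>\<^sub>0 'k) \<Rightarrow> (int \<times> int \<Rightarrow>\<^sub>0 'k::field_char_0)"
  assumes f: "A_n.cocycle2 n f"
  shows "\<exists>\<phi> g. A_n.linear_op n \<phi> \<and> basic_span n g \<and>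
    (\<forall>a\<in>A_n n. \<forall>b\<in>A_n n. f a b = A_n.delta1 \<phi> a b + g a b)"
proof -
  obtain g where g: "basic_span n g" "\<And>l m. l \<in> Lambda n \<Longrightarrow> m \<in> Lambda n \<Longrightarrow>
      f (mon l) (mon m) - f (mon m) (mon l) = g (mon l) (mon m)"
    using antisymmetric_part_basic_span[OF f] by blast
  obtain \<phi> g' where g': "A_n.linear_op n \<phi>" "basic_span n g'" "\<And>l m. l \<in> Lambda n \<Longrightarrow> m \<in> Lambda n \<Longrightarrow>
      f (mon l) (mon m) + f (mon m) (mon l) = A_n.delta1 \<phi> (mon l) (mon m) + g' (mon l) (mon m)"
    using symmetric_part_basic_span[OF f] by blast
  define \<psi> where "\<psi> = (\<lambda>a. pm_scale (1 / 2) (\<phi> a))"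
  define k where "k = (\<lambda>a b. pm_scale (1 / 2) (g a b + g' a b))"
  have \<psi>: "A_n.linear_op n \<psi>" unfolding \<psi>_def by (rule A_n.linear_op_mult_scalar[OF g'(1)])
  have k: "basic_span n k"
    unfolding k_def by (intro basic_span_scale basic_span_add g g')
  have "f a b = A_n.delta1 \<psi> a b + k a b" if ab: "a \<in> A_n n" "b \<in> A_n n" for a b
  proof (rule bilinear_eqI[OF _ _ _ ab])
    show "A_n.bilinear_op n f" using f by (simp add: A_n.cocycle2_def)
    show "A_n.bilinear_op n (\<lambda>a b. A_n.delta1 \<psi> a b + k a b)"
      by (intro A_n.bilinear_op_sum A_n.bilinear_op_delta1 \<psi> bilinear_basic_span k)
    fix l m assume lm: "l \<in> Lambda n" "m \<in> Lambda n"
    have "A_n.delta1 \<psi> (mon l) (mon m) + k (mon l) (mon m)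
        = pm_scale (1 / 2) ((f (mon l) (mon m) + f (mon m) (mon l))
            + (f (mon l) (mon m) - f (mon m) (mon l)))"
      unfolding g(2)[OF lm] g'(3)[OF lm] \<psi>_def k_def A_n.delta1_def
      by (simp add: pm_scale_simps pm_scale_mult_left pm_scale_mult_right algebra_simps)
    also have "\<dots> = pm_scale (1 / 2 + 1 / 2) (f (mon l) (mon m))"
      unfolding pm_scale_simps(5) by (simp add: pm_scale_simps(4)[symmetric])
    finally show "f (mon l) (mon m) = A_n.delta1 \<psi> (mon l) (mon m) + k (mon l) (mon m)"
      by (simp add: pm_scale_simps)
  qed
  then show ?thesis using \<psi> k by blast
qed

text \<open>
  The reduction to the span of the basic cocycles is applied to one argument at a time. After the first
  step the element of the span is again a cocycle, being cohomologous to one, which is what the bracket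
  with a coboundary in the second step requires.
\<close>

lemma bracket_exact_cocycles:
  fixes f f' :: "(int \<times> int \<Rightarrow>\<^sub>0 'k) \<Rightarrow> (int \<times> int \<Rightarrow>\<^sub>0 'k) \<Rightarrow> (int \<times> int \<Rightarrow>\<^sub>0 'k::field_char_0)"
  assumes f: "A_n.cocycle2 n f" and f': "A_n.cocycle2 n f'"
  shows "A_n.bracket_exact n f f'"
proof -
  have lift: "A_n.bracket_exact n f f'"
    if f: "A_n.cocycle2 n f" and f': "A_n.cocycle2 n f'"
      and c: "\<And>g. basic_span n g \<Longrightarrow> A_n.cocycle2 n g \<Longrightarrow> A_n.bracket_exact n g f'"
    for f f' :: "(int \<times> int \<Rightarrow>\<^sub>0 'k) \<Rightarrow> (int \<times> int \<Rightarrow>\<^sub>0 'k) \<Rightarrow> (int \<times> int \<Rightarrow>\<^sub>0 'k)"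
  proof -
    obtain \<phi> g where *: "A_n.linear_op n \<phi>" "basic_span n g"
        "\<And>a b. a \<in> A_n n \<Longrightarrow> b \<in> A_n n \<Longrightarrow> f a b = A_n.delta1 \<phi> a b + g a b"
      using cocycle_cohomologous_basic_span[OF f] by blast
    have g: "A_n.cocycle2 n g"
      unfolding A_n.cocycle2_def
    proof (intro conjI ballI bilinear_basic_span *)
      fix a b c :: "int \<times> int \<Rightarrow>\<^sub>0 'k"
      assume abc: "a \<in> A_n n" "b \<in> A_n n" "c \<in> A_n n"
      have "A_n.delta2 f a b c = A_n.delta2 (A_n.delta1 \<phi>) a b c + A_n.delta2 g a b c"
        using abc by (simp add: A_n.delta2_def *(3) algebra_simps)
      then show "A_n.delta2 g a b c = 0"
        using f A_n.cocycle2_delta1[OF *(1)] abc by (simp add: A_n.cocycle2_def)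
    qed
    have l: "A_n.bilinear_op n f'" using f' by (simp add: A_n.cocycle2_def)
    have "A_n.bracket_exact n (\<lambda>a b. A_n.delta1 \<phi> a b + pm_scale 1 (g a b)) f'"
      by (intro A_n.bracket_exact_lincomb A_n.bilinear_op_delta1 A_n.bracket_exact_delta1 bilinear_basic_span * c g f' l)
    moreover have "A_n.bilinear_op n (\<lambda>a b. A_n.delta1 \<phi> a b + pm_scale 1 (g a b))"
      by (intro A_n.bilinear_op_sum A_n.bilinear_op_mult_scalar A_n.bilinear_op_delta1 bilinear_basic_span *)
    ultimately show ?thesis
      using A_n.bracket_exact_cong[OF l] *(3) by (simp add: pm_scale_simps)
  qed
  show ?thesis
    by (intro lift[OF f f'] A_n.bracket_exact_sym[OF lift[OF f']] bracket_exact_basic_span)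
qed

theorem proposition5p3:
  fixes n :: nat
    and X Y :: "(((int \<times> int) \<Rightarrow>\<^sub>0 'k::field_char_0) list \<Rightarrow> ((int \<times> int) \<Rightarrow>\<^sub>0 'k)) set"
  assumes "n \<ge> 1"
    and "X \<in> carrier (k_algebra.HH pm_scale (A_n n) 2)"
    and "Y \<in> carrier (k_algebra.HH pm_scale (A_n n) 2)"
  shows "k_algebra.gerstenhaber_product pm_scale (A_n n) 2 2 X Y
       = \<one>\<^bsub>k_algebra.HH pm_scale (A_n n) 3\<^esub>"
  using assms(2,3)
  by (intro A_n.gerstenhaber_product_trivial bracket_exact_cocycles)

end
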